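(* Let $\mu$ be a diagram with $d$ boxes on the main diagonal. The Schur function $s_\mu(x)$ has the expansion $$s_\mu(x)=\sum_\lambda(-1)^{m(\lambda/\mu)}\det\big[e_{\lambda_i-\mu_j-i+j}(a_0,a_{-1},\dots,a_{i-\lambda_i+1})\big]_{i,j=1}^d\;\det\big[h_{\lambda_i-\mu_j-i+j}(a_1,a_2,\dots,a_{i-\lambda_i})\big]_{i,j\geqslant d+1}\;\widehat s_\lambda(x\|a),$$ summed over diagrams $\lambda$ which contain $\mu$ and such that $\lambda$ has $d$ boxes on the main diagonal, where $m(\lambda/\mu)$ denotes the total number of boxes of $\lambda/\mu$ in rows $1,\dots,d$.
   Context: Let $a=(a_i)_{i\in\mathbb Z}$ be a sequence of commuting indeterminates and $\mathbb Q[a]$ the polynomial ring in the $a_i$; $x=(x_1,x_2,\dots)$; $\ell(\lambda)$ is the number of nonzero parts of $\lambda$. $h_k(\cdot)$ and $e_k(\cdot)$ are the usual complete and elementary symmetric polynomials in the indicated (possibly empty) finite set of variables, with $h_0=e_0=1$ and $h_k=e_k=0$ for $k<0$; an empty determinant is $1$. The second determinant may be taken over $d+1\leqslant i,j\leqslant N$ for any $N\geqslant\ell(\lambda)$, the value being independent of $N$. Dual Schur functions: let $\widehat\Lambda(x\|a)$ be the ring of formal (possibly infinite) sums $\sum_{\lambda}c_\lambda(a)s_\lambda(x)$, $c_\lambda(a)\in\mathbb Q[a]$, with $s_\lambda(x)$ the ordinary Schur functions. For a partition $\lambda$ with $d$ boxes on the main diagonal and $n\geqslant\ell(\lambda)$,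 $$\widehat s_\lambda(x_1,\dots,x_n\|a)=\frac{\det[A_{ij}]_{i,j=1}^n}{\prod_{1\leqslant i<j\leqslant n}(x_i-x_j)},$$ where $A_{ij}=\dfrac{x_i^{\lambda_j+n-j}}{(1-a_0x_i)(1-a_{-1}x_i)\cdots(1-a_{j-\lambda_j}x_i)}$ for $1\leqslant j\leqslant d$ and $A_{ij}=x_i^{\lambda_j+n-j}(1-a_1x_i)\cdots(1-a_{j-\lambda_j-1}x_i)$ for $d<j\leqslant n$; it is $0$ if $\ell(\lambda)>n$. These are compatible with setting $x_n=0$ and define $\widehat s_\lambda(x\|a)\in\widehat\Lambda(x\|a)$. *)

theory Defs
  imports "HOL-Library.Poly_Mapping" "HOL-Library.Multiset" "Jordan_Normal_Form.Determinant"
begin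

section \<open>Formal power series in countably many variables\<close>

text \<open>
  A monomial is a finitely supported exponent vector \<open>\<alpha> :: nat \<Rightarrow>\<^sub>0 nat\<close>, and a power series is an
  arbitrary coefficient function on monomials. Position \<open>i\<close> of the exponent vector belongs to
  the variable \<open>x\<^bsub>i+1\<^esub>\<close>.
\<close>

typedef 'a mps = "UNIV :: ((nat \<Rightarrow>\<^sub>0 nat) \<Rightarrow> 'a) set"
  morphisms mcoeff Abs_mps by simp

lemma mcoeff_Abs_mps [simp]: "mcoeff (Abs_mps f) = f"
  by (simp add: Abs_mps_inverse)

lemma mps_eqI: "(\<And>\<alpha>. mcoeff F \<alpha> = mcoeff G \<alpha>) \<Longrightarrow> F = G"
  by (metis mcoeff_inject ext)

definition splits :: "(nat \<Rightarrow>\<^sub>0 nat) \<Rightarrow> ((nat \<Rightarrow>\<^sub>0 nat) \<times> (nat \<Rightarrow>\<^sub>0 nat)) set" where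
  "splits \<alpha> = {(\<beta>, \<gamma>). \<beta> + \<gamma> = \<alpha>}"

lemma finite_splits: "finite (splits \<alpha>)"
proof -
  let ?M = "Max (insert 0 (Poly_Mapping.lookup \<alpha> ` Poly_Mapping.keys \<alpha>))"
  let ?S = "{f :: nat \<Rightarrow> nat. \<forall>k. (k \<in> Poly_Mapping.keys \<alpha> \<longrightarrow> f k \<in> {..?M}) \<and> (k \<notin> Poly_Mapping.keys \<alpha> \<longrightarrow> f k = 0)}"
  have bound: "Poly_Mapping.lookup \<alpha> k \<le> ?M" if "k \<in> Poly_Mapping.keys \<alpha>" for k
    using that by (intro Max_ge) auto
  have fin: "finite ?S"
    by (rule finite_set_of_finite_funs) auto
  have le: "Poly_Mapping.lookup \<beta> k \<le> Poly_Mapping.lookup \<alpha> k \<and> Poly_Mapping.lookup \<gamma> k \<le> Poly_Mapping.lookup \<alpha> k"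
    if "(\<beta>, \<gamma>) \<in> splits \<alpha>" for \<beta> \<gamma> k
    using that by (auto simp: splits_def lookup_add)
  have "Poly_Mapping.lookup \<beta> \<in> ?S \<and> Poly_Mapping.lookup \<gamma> \<in> ?S" if "(\<beta>, \<gamma>) \<in> splits \<alpha>" for \<beta> \<gamma>
  proof -
    have "Poly_Mapping.lookup \<delta> \<in> ?S" if d: "\<And>k. Poly_Mapping.lookup \<delta> k \<le> Poly_Mapping.lookup \<alpha> k" for \<delta>
    proof -
      have "Poly_Mapping.lookup \<delta> k \<le> ?M" if "k \<in> Poly_Mapping.keys \<alpha>" for k
        using order_trans[OF d bound[OF that]] .
      moreover have "Poly_Mapping.lookup \<delta> k = 0" if "k \<notin> Poly_Mapping.keys \<alpha>" for k
        using d[of k] that by (simp add: in_keys_iff)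
      ultimately show ?thesis by auto
    qed
    then show ?thesis using le[OF that] by blast
  qed
  then have "(\<lambda>(\<beta>, \<gamma>). (Poly_Mapping.lookup \<beta>, Poly_Mapping.lookup \<gamma>)) ` splits \<alpha> \<subseteq> ?S \<times> ?S"
    by auto
  moreover have "inj_on (\<lambda>(\<beta>, \<gamma>). (Poly_Mapping.lookup \<beta>, Poly_Mapping.lookup \<gamma>)) (splits \<alpha>)"
    by (auto simp: inj_on_def lookup_inject)
  ultimately show ?thesis
    using fin by (meson finite_SigmaI finite_imageD finite_subset)
qed

instantiation mps :: (comm_ring_1) comm_ring_1
begin

definition zero_mps :: "'a mps" where "0 = Abs_mps (\<lambda>_. 0)"
definition one_mps :: "'a mps" where "1 = Abs_mps (\<lambda>\<alpha>. if \<alpha> = 0 then 1 else 0)"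
definition plus_mps :: "'a mps \<Rightarrow> 'a mps \<Rightarrow> 'a mps" where
  "F + G = Abs_mps (\<lambda>\<alpha>. mcoeff F \<alpha> + mcoeff G \<alpha>)"
definition minus_mps :: "'a mps \<Rightarrow> 'a mps \<Rightarrow> 'a mps" where
  "F - G = Abs_mps (\<lambda>\<alpha>. mcoeff F \<alpha> - mcoeff G \<alpha>)"
definition uminus_mps :: "'a mps \<Rightarrow> 'a mps" where
  "- F = Abs_mps (\<lambda>\<alpha>. - mcoeff F \<alpha>)"
definition times_mps :: "'a mps \<Rightarrow> 'a mps \<Rightarrow> 'a mps" where
  "F * G = Abs_mps (\<lambda>\<alpha>. \<Sum>(\<beta>, \<gamma>) \<in> splits \<alpha>. mcoeff F \<beta> * mcoeff G \<gamma>)"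

instance
proof
  fix F G H :: "'a mps"
  show "F + G + H = F + (G + H)" "F + G = G + F" "0 + F = F" "- F + F = 0" "F - G = F + - G"
    by (auto intro!: mps_eqI
        simp: zero_mps_def plus_mps_def minus_mps_def uminus_mps_def algebra_simps)
  show "F * G = G * F"
    unfolding times_mps_def
    by (rule arg_cong[where f = Abs_mps], rule ext,
        rule sum.reindex_bij_witness[where i = "\<lambda>(x, y). (y, x)" and j = "\<lambda>(x, y). (y, x)"])
       (auto simp: splits_def add.commute mult.commute)
  show "(F + G) * H = F * H + G * H"
    by (auto intro!: mps_eqI simp: times_mps_def plus_mps_def distrib_right
        simp flip: sum.distrib intro!: sum.cong)
  show "1 * F = F"
  proof (rule mps_eqI)
    fix \<alpha>
    have "(\<Sum>(\<beta>, \<gamma>) \<in> splits \<alpha>. (if \<beta> = 0 then 1 else 0) * mcoeff F \<gamma>)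
        = (\<Sum>(\<beta>, \<gamma>) \<in> {(0 :: nat \<Rightarrow>\<^sub>0 nat, \<alpha>)}. (if \<beta> = 0 then 1 else 0) * mcoeff F \<gamma>)"
    proof (rule sum.mono_neutral_right)
      show "finite (splits \<alpha>)" by (rule finite_splits)
      show "{(0 :: nat \<Rightarrow>\<^sub>0 nat, \<alpha>)} \<subseteq> splits \<alpha>" by (simp add: splits_def)
      show "\<forall>p \<in> splits \<alpha> - {(0 :: nat \<Rightarrow>\<^sub>0 nat, \<alpha>)}. (case p of (\<beta>, \<gamma>) \<Rightarrow> (if \<beta> = 0 then 1 else 0) * mcoeff F \<gamma>) = 0"
      proof
        fix p assume "p \<in> splits \<alpha> - {(0 :: nat \<Rightarrow>\<^sub>0 nat, \<alpha>)}"
        then have "fst p \<noteq> 0" by (cases p) (auto simp: splits_def)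
        then show "(case p of (\<beta>, \<gamma>) \<Rightarrow> (if \<beta> = 0 then 1 else 0) * mcoeff F \<gamma>) = 0"
          by (simp add: case_prod_beta)
      qed
    qed
    also have "\<dots> = mcoeff F \<alpha>"
      by simp
    finally show "mcoeff (1 * F) \<alpha> = mcoeff F \<alpha>"
      by (simp add: times_mps_def one_mps_def)
  qed
  have "mcoeff (0 :: 'a mps) 0 \<noteq> mcoeff 1 0"
    by (simp add: zero_mps_def one_mps_def)
  then show "(0 :: 'a mps) \<noteq> 1"
    by auto
  show "F * G * H = F * (G * H)"
  proof (rule mps_eqI)
    fix \<alpha>
    let ?t = "\<lambda>\<beta> \<gamma> \<epsilon>. mcoeff F \<beta> * mcoeff G \<gamma> * mcoeff H \<epsilon>"
    have "mcoeff (F * G * H) \<alpha> = (\<Sum>p \<in> splits \<alpha>. \<Sum>q \<in> splits (fst p). ?t (fst q) (snd q) (snd p))"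
      by (simp add: times_mps_def sum_distrib_right case_prod_beta)
    also have "\<dots> = (\<Sum>(p, q) \<in> Sigma (splits \<alpha>) (\<lambda>p. splits (fst p)). ?t (fst q) (snd q) (snd p))"
      by (subst sum.Sigma) (auto simp: finite_splits)
    also have "\<dots> = (\<Sum>(p, q) \<in> Sigma (splits \<alpha>) (\<lambda>p. splits (snd p)). ?t (fst p) (fst q) (snd q))"
      by (rule sum.reindex_bij_witness[where
            i = "\<lambda>((b, g), (c, e)). ((b + c, e), (b, c))" and
            j = "\<lambda>((b, g), (c, e)). ((c, e + g), (e, g))"])
         (auto simp: splits_def, simp_all only: add.assoc)
    also have "\<dots> = (\<Sum>p \<in> splits \<alpha>. \<Sum>q \<in> splits (snd p). ?t (fst p) (fst q) (snd q))"
      by (subst sum.Sigma) (auto simp: finite_splits)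
    also have "\<dots> = mcoeff (F * (G * H)) \<alpha>"
      by (simp add: times_mps_def sum_distrib_left case_prod_beta mult.assoc)
    finally show "mcoeff (F * G * H) \<alpha> = mcoeff (F * (G * H)) \<alpha>" .
  qed
qed

end

definition mps_const :: "'a::zero \<Rightarrow> 'a mps" where
  "mps_const c = Abs_mps (\<lambda>\<alpha>. if \<alpha> = 0 then c else 0)"

text \<open>The variable \<open>x\<^sub>i\<close>, for \<open>i \<ge> 1\<close>.\<close>

definition xvar :: "nat \<Rightarrow> 'a::zero_neq_one mps" where
  "xvar i = Abs_mps (\<lambda>\<alpha>. if \<alpha> = Poly_Mapping.single (i - 1) 1 then 1 else 0)"

text \<open>The substitution \<open>x\<^sub>k = 0\<close> for all \<open>k > n\<close>.\<close>

definition restrict_vars :: "nat \<Rightarrow> 'a::zero mps \<Rightarrow> 'a mps" where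
  "restrict_vars n F = Abs_mps (\<lambda>\<alpha>. if Poly_Mapping.keys \<alpha> \<subseteq> {..<n} then mcoeff F \<alpha> else 0)"

text \<open>The quotient \<open>F / G\<close>, meaningful when \<open>G\<close> divides \<open>F\<close> and is not a zero divisor.\<close>

definition mps_quot :: "'a::comm_ring_1 mps \<Rightarrow> 'a mps \<Rightarrow> 'a mps" where
  "mps_quot F G = (THE Q. Q * G = F)"

text \<open>
  Formal infinite sums: every monomial receives nonzero contributions from only finitely many
  summands.
\<close>

definition has_formal_sum :: "('i \<Rightarrow> 'a::comm_monoid_add mps) \<Rightarrow> 'i set \<Rightarrow> 'a mps \<Rightarrow> bool" where
  "has_formal_sum f I S \<longleftrightarrow>
     (\<forall>\<alpha>. finite {i \<in> I. mcoeff (f i) \<alpha> \<noteq> 0} \<and>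
          mcoeff S \<alpha> = (\<Sum>i \<in> {i \<in> I. mcoeff (f i) \<alpha> \<noteq> 0}. mcoeff (f i) \<alpha>))"


section \<open>The coefficient ring and symmetric polynomials\<close>

text \<open>The polynomial ring \<open>\<rat>[a]\<close> in the indeterminates \<open>a\<^sub>i\<close>, \<open>i \<in> \<int>\<close>.\<close>

type_synonym qa = "(int \<Rightarrow>\<^sub>0 nat) \<Rightarrow>\<^sub>0 rat"

definition avar :: "int \<Rightarrow> qa" where
  "avar i = Poly_Mapping.single (Poly_Mapping.single i 1) 1"

text \<open>\<open>e\<^sub>k\<close> and \<open>h\<^sub>k\<close> in the variables \<open>a\<^sub>i\<close>, \<open>i \<in> S\<close>, for a finite index set \<open>S\<close>.\<close>

definition elem_sym :: "int \<Rightarrow> int set \<Rightarrow> qa" where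
  "elem_sym k S = (if k < 0 then 0 else \<Sum>T | T \<subseteq> S \<and> card T = nat k. \<Prod>i\<in>T. avar i)"

definition compl_sym :: "int \<Rightarrow> int set \<Rightarrow> qa" where
  "compl_sym k S =
     (if k < 0 then 0 else \<Sum>M | set_mset M \<subseteq> S \<and> size M = nat k. \<Prod>i\<in>#M. avar i)"

text \<open>The determinant of \<open>[f i j]\<close> with \<open>l \<le> i, j \<le> u\<close>; it is \<open>1\<close> if \<open>u < l\<close>.\<close>

definition det_range :: "nat \<Rightarrow> nat \<Rightarrow> (nat \<Rightarrow> nat \<Rightarrow> 'a::comm_ring_1) \<Rightarrow> 'a" where
  "det_range l u f = det (mat (u + 1 - l) (u + 1 - l) (\<lambda>(i, j). f (l + i) (l + j)))"


section \<open>Partitions\<close>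

text \<open>A partition is the list of its nonzero parts, so \<open>\<ell>(\<lambda>)\<close> is the length of the list.\<close>

definition is_partition :: "nat list \<Rightarrow> bool" where
  "is_partition la \<longleftrightarrow> sorted_wrt (\<ge>) la \<and> 0 \<notin> set la"

text \<open>Parts are numbered from \<open>1\<close>; all parts beyond the length are \<open>0\<close>.\<close>

definition part :: "nat list \<Rightarrow> nat \<Rightarrow> nat" where
  "part la i = (if 1 \<le> i \<and> i \<le> length la then la ! (i - 1) else 0)"

definition diagram :: "nat list \<Rightarrow> (nat \<times> nat) set" where
  "diagram la = {(i, j). 1 \<le> i \<and> 1 \<le> j \<and> j \<le> part la i}"

definition num_diag :: "nat list \<Rightarrow> nat" where
  "num_diag la = card {(i, j) \<in> diagram la. i = j}"


section \<open>Schur functions and dual Schur functions\<close>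

definition vandermonde :: "nat \<Rightarrow> qa mps" where
  "vandermonde n = (\<Prod>(i, j) \<in> {(i, j). 1 \<le> i \<and> i < j \<and> j \<le> n}. xvar i - xvar j)"

text \<open>The ordinary Schur polynomial \<open>s\<^sub>\<lambda>(x\<^sub>1, \<dots>, x\<^sub>n)\<close> as a ratio of alternants.\<close>

definition schur_fin :: "nat \<Rightarrow> nat list \<Rightarrow> qa mps" where
  "schur_fin n la =
     (if length la > n then 0
      else mps_quot (det_range 1 n (\<lambda>i j. xvar i ^ (part la j + n - j))) (vandermonde n))"

definition dual_entry :: "nat list \<Rightarrow> nat \<Rightarrow> nat \<Rightarrow> nat \<Rightarrow> qa mps" where
  "dual_entry la n i j =
     (if j \<le> num_diag la
      then mps_quot (xvar i ^ (part la j + n - j))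
             (\<Prod>k \<in> {int j - int (part la j)..0}. 1 - mps_const (avar k) * xvar i)
      else xvar i ^ (part la j + n - j) *
             (\<Prod>k \<in> {1..int j - int (part la j) - 1}. 1 - mps_const (avar k) * xvar i))"

definition dual_schur_fin :: "nat \<Rightarrow> nat list \<Rightarrow> qa mps" where
  "dual_schur_fin n la =
     (if length la > n then 0
      else mps_quot (det_range 1 n (dual_entry la n)) (vandermonde n))"

text \<open>
  The functions in infinitely many variables are determined by their specialisations
  \<open>x\<^bsub>n+1\<^esub> = x\<^bsub>n+2\<^esub> = \<dots> = 0\<close>. The ring of formal sums \<open>\<Sum> c\<^sub>\<lambda>(a) s\<^sub>\<lambda>(x)\<close> is regarded as the subring of
  symmetric series in \<^typ>\<open>qa mps\<close>. Since \<open>s\<^sub>\<lambda>\<close> is homogeneous of degree \<open>|\<lambda>|\<close> and each degree involves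
  finitely many partitions, an infinite sum in that ring is an infinite sum in the sense of
  \<^const>\<open>has_formal_sum\<close>.
\<close>

definition schur :: "nat list \<Rightarrow> qa mps" where
  "schur la = (THE F. \<forall>n. restrict_vars n F = schur_fin n la)"

definition dual_schur :: "nat list \<Rightarrow> qa mps" where
  "dual_schur la = (THE F. \<forall>n. restrict_vars n F = dual_schur_fin n la)"

end

theory Submission
  imports Defs
begin

text \<open>
  A Laurent series column \<open>x\<^sup>n \<Sum>\<^sub>k c\<^sub>k x\<^sup>k\<close> of an alternant in \<open>x\<^sub>1, \<dots>, x\<^sub>n\<close> is replaced by its divided
  differences at \<open>x\<^sub>i, \<dots>, x\<^sub>n\<close>; this divides the determinant by the Vandermonde product and makes the
  dependence on \<open>n\<close> trivial. In this form the columns of \<open>s\<^sub>\<mu>\<close> are the monomials \<open>x\<^sup>m\<close>, \<open>m = \<mu>\<^sub>j - j\<close>, and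
  those of the dual Schur function of \<open>\<lambda>\<close> are series \<open>C\<^sub>t\<close>, \<open>t = \<lambda>\<^sub>j - j\<close>, that do not otherwise depend on
  \<open>\<lambda>\<close>. The relation between elementary and complete symmetric polynomials expands \<open>x\<^sup>m\<close> in the \<open>C\<^sub>t\<close>,
  separately for nonnegative and negative exponents, and the Cauchy--Binet formula (applied modulo terms
  of high degree, so that all sums are finite) turns this into the expansion of \<open>s\<^sub>\<mu>\<close>. The coefficient
  matrix is block diagonal with diagonal blocks of sizes given by the numbers of diagonal boxes, which
  produces the two determinants and kills all other \<open>\<lambda>\<close>.
\<close>

section \<open>Power series: coefficients, degree, restriction\<close>

lemma mcoeff_simps [simp]:
  "mcoeff 0 \<alpha> = 0"
  "mcoeff (F + G) \<alpha> = mcoeff F \<alpha> + mcoeff G \<alpha>"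
  "mcoeff (F - G) \<alpha> = mcoeff F \<alpha> - mcoeff G \<alpha>"
  "mcoeff (- F) \<alpha> = - mcoeff F \<alpha>"
  by (simp_all add: zero_mps_def plus_mps_def minus_mps_def uminus_mps_def)

lemma mcoeff_one: "mcoeff 1 \<alpha> = (if \<alpha> = 0 then 1 else 0)"
  by (simp add: one_mps_def)

lemma mcoeff_mult: "mcoeff (F * G) \<alpha> = (\<Sum>(\<beta>, \<gamma>) \<in> splits \<alpha>. mcoeff F \<beta> * mcoeff G \<gamma>)"
  by (simp add: times_mps_def)

lemma mcoeff_sum [simp]: "mcoeff (sum f A) \<alpha> = (\<Sum>i\<in>A. mcoeff (f i) \<alpha>)"
  by (induction A rule: infinite_finite_induct) auto

lemma keys_plus_nat: "Poly_Mapping.keys (\<beta> + \<gamma> :: 'k \<Rightarrow>\<^sub>0 nat) = Poly_Mapping.keys \<beta> \<union> Poly_Mapping.keys \<gamma>"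
  by (auto simp: in_keys_iff lookup_add)

definition mdeg :: "('k \<Rightarrow>\<^sub>0 nat) \<Rightarrow> nat" where
  "mdeg \<alpha> = (\<Sum>k\<in>Poly_Mapping.keys \<alpha>. Poly_Mapping.lookup \<alpha> k)"

lemma mdeg_superset:
  "finite S \<Longrightarrow> Poly_Mapping.keys \<alpha> \<subseteq> S \<Longrightarrow> mdeg \<alpha> = (\<Sum>k\<in>S. Poly_Mapping.lookup \<alpha> k)"
  unfolding mdeg_def by (rule sum.mono_neutral_left) (auto simp: in_keys_iff)

lemma mdeg_plus: "mdeg (\<alpha> + \<beta>) = mdeg \<alpha> + mdeg \<beta>"
proof -
  let ?S = "Poly_Mapping.keys \<alpha> \<union> Poly_Mapping.keys \<beta>"
  have "mdeg (\<alpha> + \<beta>) = (\<Sum>k\<in>?S. Poly_Mapping.lookup (\<alpha> + \<beta>) k)"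
    by (rule mdeg_superset) (auto simp: keys_plus_nat)
  also have "\<dots> = mdeg \<alpha> + mdeg \<beta>"
    by (subst (1 2) mdeg_superset[of ?S]) (auto simp: lookup_add sum.distrib)
  finally show ?thesis .
qed

lemma mdeg_zero [simp]: "mdeg 0 = 0"
  by (simp add: mdeg_def)

lemma mdeg_single [simp]: "mdeg (Poly_Mapping.single k n) = n"
  by (simp add: mdeg_def)

lemma mcoeff_const_mult: "mcoeff (mps_const c * F) \<alpha> = c * mcoeff F \<alpha>"
proof -
  have "mcoeff (mps_const c * F) \<alpha> = (\<Sum>(\<beta>, \<gamma>) \<in> {(0, \<alpha>)}. mcoeff (mps_const c) \<beta> * mcoeff F \<gamma>)"
    unfolding mcoeff_mult
    by (rule sum.mono_neutral_right)
      (auto simp: finite_splits, auto simp: splits_def mps_const_def split: if_splits)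
  then show ?thesis by (simp add: mps_const_def)
qed

lemma mps_const_one: "mps_const 1 = 1"
  by (rule mps_eqI) (simp add: mps_const_def mcoeff_one)

lemma mps_const_zero: "mps_const 0 = 0"
  by (rule mps_eqI) (simp add: mps_const_def)

lemma mps_const_add: "mps_const (c + d) = mps_const c + mps_const (d :: 'a :: comm_ring_1)"
  by (rule mps_eqI) (simp add: mps_const_def)

lemma mps_const_mult: "mps_const (c * d) = mps_const c * mps_const (d :: 'a :: comm_ring_1)"
  by (rule mps_eqI) (simp only: mcoeff_const_mult, simp add: mps_const_def)

lemma mps_const_hom: "comm_ring_hom (mps_const :: 'a :: comm_ring_1 \<Rightarrow> _)"
  by unfold_locales (auto simp: mps_const_one mps_const_zero mps_const_add mps_const_mult)

text \<open>Position \<open>i - 1\<close> holds the exponent of \<open>xvar i\<close>; the case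
  distinction is forced by exponent subtraction, which truncates at 0.\<close>

lemma mcoeff_xvar_mult:
  "mcoeff (xvar i * F) \<alpha> =
    (if Poly_Mapping.lookup \<alpha> (i - 1) = 0 then 0 else mcoeff F (\<alpha> - Poly_Mapping.single (i - 1) 1))"
proof -
  let ?s = "Poly_Mapping.single (i - 1) (1::nat)"
  have *: "mcoeff (xvar i * F) \<alpha> = (\<Sum>(\<beta>, \<gamma>) \<in> splits \<alpha> \<inter> {p. fst p = ?s}. mcoeff F \<gamma>)"
    unfolding mcoeff_mult xvar_def
    by (simp add: sum.inter_restrict finite_splits case_prod_beta if_distrib[of "\<lambda>x. x * _"] cong: if_cong)
  show ?thesis
  proof (cases "Poly_Mapping.lookup \<alpha> (i - 1) = 0")
    case True
    then have "splits \<alpha> \<inter> {p. fst p = ?s} = {}"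
      by (auto simp: splits_def lookup_add)
    then show ?thesis using True by (simp add: *)
  next
    case False
    have "?s + (\<alpha> - ?s) = \<alpha>"
    proof (rule poly_mapping_eqI)
      fix k show "Poly_Mapping.lookup (?s + (\<alpha> - ?s)) k = Poly_Mapping.lookup \<alpha> k"
        using False by (auto simp: lookup_add lookup_minus lookup_single when_def)
    qed
    then have "splits \<alpha> \<inter> {p. fst p = ?s} = {(?s, \<alpha> - ?s)}"
      by (auto simp: splits_def)
    then show ?thesis using False by (simp add: *)
  qed
qed

lemma mcoeff_restrict_vars:
  "mcoeff (restrict_vars n F) \<alpha> = (if Poly_Mapping.keys \<alpha> \<subseteq> {..<n} then mcoeff F \<alpha> else 0)"
  by (simp add: restrict_vars_def)

text \<open>Exponents are naturals and cannot cancel, so a product monomial involves only the first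
  n variables exactly when both factors do.\<close>

lemma restrict_vars_hom: "comm_ring_hom (restrict_vars n :: 'a :: comm_ring_1 mps \<Rightarrow> _)"
proof unfold_locales
  show "restrict_vars n (0 :: 'a mps) = 0" "restrict_vars n (1 :: 'a mps) = 1"
    by (auto intro!: mps_eqI simp: mcoeff_restrict_vars mcoeff_one)
  fix F G :: "'a mps"
  show "restrict_vars n (F + G) = restrict_vars n F + restrict_vars n G"
    by (auto intro!: mps_eqI simp: mcoeff_restrict_vars)
  show "restrict_vars n (F * G) = restrict_vars n F * restrict_vars n G"
  proof (rule mps_eqI)
    fix \<alpha>
    show "mcoeff (restrict_vars n (F * G)) \<alpha> = mcoeff (restrict_vars n F * restrict_vars n G) \<alpha>"
    proof (cases "Poly_Mapping.keys \<alpha> \<subseteq> {..<n}")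
      case True
      then show ?thesis
        by (auto simp: mcoeff_restrict_vars mcoeff_mult splits_def keys_plus_nat intro!: sum.cong)
    next
      case False
      then have "(\<Sum>(\<beta>, \<gamma>) \<in> splits \<alpha>. mcoeff (restrict_vars n F) \<beta> * mcoeff (restrict_vars n G) \<gamma>) = 0"
        by (intro sum.neutral) (auto simp: mcoeff_restrict_vars splits_def keys_plus_nat)
      then show ?thesis using False by (simp add: mcoeff_restrict_vars mcoeff_mult)
    qed
  qed
qed

lemma restrict_vars_restrict_vars:
  "restrict_vars m (restrict_vars n F) = restrict_vars (min m n) F"
  by (rule mps_eqI) (auto simp: mcoeff_restrict_vars)

section \<open>Congruence modulo terms of high degree\<close>

text \<open>Congruence modulo series of order greater than \<open>D\<close>. It cuts the infinite
  column expansions down to finite sums, as Cauchy-Binet requires.\<close>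

definition cong_deg :: "nat \<Rightarrow> 'a mps \<Rightarrow> 'a mps \<Rightarrow> bool" where
  "cong_deg D F G \<longleftrightarrow> (\<forall>\<alpha>. mdeg \<alpha> \<le> D \<longrightarrow> mcoeff F \<alpha> = mcoeff G \<alpha>)"

lemma cong_deg_refl: "cong_deg D F F"
  by (simp add: cong_deg_def)

lemma cong_deg_mult:
  "cong_deg D F F' \<Longrightarrow> cong_deg D G G' \<Longrightarrow> cong_deg D (F * G) (F' * G')"
  unfolding cong_deg_def
  by (auto simp: mcoeff_mult splits_def mdeg_plus intro!: sum.cong)

lemma cong_deg_prod:
  "(\<And>i. i \<in> A \<Longrightarrow> cong_deg D (f i) (g i)) \<Longrightarrow> cong_deg D (prod f A) (prod g A)"
  by (induction A rule: infinite_finite_induct) (auto simp: cong_deg_refl cong_deg_mult)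

lemma cong_deg_sum:
  "(\<And>i. i \<in> A \<Longrightarrow> cong_deg D (f i) (g i)) \<Longrightarrow> cong_deg D (sum f A) (sum g A)"
  unfolding cong_deg_def by (auto intro!: sum.cong)

lemma cong_deg_det_range:
  assumes "\<And>i j. l \<le> i \<Longrightarrow> i \<le> u \<Longrightarrow> l \<le> j \<Longrightarrow> j \<le> u \<Longrightarrow> cong_deg D (f i j) (g i j)"
  shows "cong_deg D (det_range l u f) (det_range l u g)"
proof -
  have "l + p i \<le> u" if "p permutes {0..<Suc u - l}" "i < Suc u - l" for p i
    using permutes_in_image[OF that(1), of i] that(2) by auto
  then show ?thesis
    unfolding det_range_def det_def
    by (auto intro!: cong_deg_sum cong_deg_mult cong_deg_refl cong_deg_prod assms
        simp: permutes_in_image)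
qed

section \<open>Determinants over index ranges\<close>

lemma det_range_cong:
  assumes "\<And>i j. l \<le> i \<Longrightarrow> i \<le> u \<Longrightarrow> l \<le> j \<Longrightarrow> j \<le> u \<Longrightarrow> f i j = g i j"
  shows "det_range l u f = det_range l u g"
  unfolding det_range_def by (rule arg_cong[where f = det]) (auto intro!: eq_matI assms)

lemma det_range_hom:
  assumes "comm_ring_hom h"
  shows "h (det_range l u f) = det_range l u (\<lambda>i j. h (f i j))"
proof -
  interpret comm_ring_hom h by fact
  show ?thesis unfolding det_range_def
    by (subst hom_det[symmetric], rule arg_cong[where f = det], rule eq_matI) auto
qed

lemma det_range_transpose: "det_range l u (\<lambda>i j. f j i) = det_range l u f"
  unfolding det_range_def
  by (subst det_transpose[symmetric]) (auto intro!: arg_cong[where f = det])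

text \<open>In each Leibniz term every row factor and, after reindexing by the permutation, every
  column factor occurs once. This later pulls the signs out of the elementary symmetric
  block.\<close>

lemma det_range_scale:
  "det_range l u (\<lambda>i j. r i * s j * f i j) = prod r {l..u} * prod s {l..u} * det_range l u f"
proof -
  define m where "m = u + 1 - l"
  have p: "(\<Prod>i = 0..<m. g (l + i)) = prod g {l..u}" for g :: "nat \<Rightarrow> 'a"
    by (rule prod.reindex_bij_witness[where i = "\<lambda>i. i - l" and j = "\<lambda>i. l + i"]) (auto simp: m_def)
  have "signof p * (\<Prod>i = 0..<m. r (l + i) * s (l + p i) * f (l + i) (l + p i))
      = prod r {l..u} * prod s {l..u} * (signof p * (\<Prod>i = 0..<m. f (l + i) (l + p i)))"
    if "p permutes {0..<m}" for p
  proof -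
    have "(\<Prod>i = 0..<m. s (l + p i)) = (\<Prod>i = 0..<m. s (l + i))"
      using prod.permute[OF that, of "\<lambda>i. s (l + i)"] by (simp add: comp_def)
    then show ?thesis unfolding prod.distrib p by (simp add: p[of s] p[of r])
  qed
  then show ?thesis
    unfolding det_range_def m_def[symmetric]
    by (subst (1 2) det_def'[of _ m])
      (auto simp: sum_distrib_left permutes_in_image intro!: sum.cong)
qed

text \<open>The bounds on \<open>m\<close> admit an empty block on either side, which covers the
  cases \<open>d = 0\<close> and \<open>n = length la\<close> below.\<close>

lemma det_range_block:
  fixes f :: "nat \<Rightarrow> nat \<Rightarrow> 'a :: idom"
  assumes "l \<le> m + 1" "m \<le> u" and z: "\<And>i j. m < i \<Longrightarrow> i \<le> u \<Longrightarrow> l \<le> j \<Longrightarrow> j \<le> m \<Longrightarrow> f i j = 0"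
  shows "det_range l u f = det_range l m f * det_range (m + 1) u f"
proof -
  let ?p = "m + 1 - l" and ?q = "u - m"
  let ?A1 = "mat ?p ?p (\<lambda>(i, j). f (l + i) (l + j))"
  let ?A2 = "mat ?p ?q (\<lambda>(i, j). f (l + i) (m + 1 + j))"
  let ?A4 = "mat ?q ?q (\<lambda>(i, j). f (m + 1 + i) (m + 1 + j))"
  have "mat (u + 1 - l) (u + 1 - l) (\<lambda>(i, j). f (l + i) (l + j)) = four_block_mat ?A1 ?A2 (0\<^sub>m ?q ?p) ?A4"
    using assms(1,2) by (intro eq_matI) (auto intro!: z arg_cong2[where f = f])
  then show ?thesis
    unfolding det_range_def
    by (simp add: det_four_block_mat_lower_left_zero[of _ ?p _ ?q])
qed

lemma det_range_zero_col:
  assumes "l \<le> k" "k \<le> u" "\<And>i. l \<le> i \<Longrightarrow> i \<le> u \<Longrightarrow> f i k = 0"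
  shows "det_range l u f = 0"
proof -
  let ?m = "u + 1 - l"
  let ?A = "mat ?m ?m (\<lambda>(i, j). f (l + i) (l + j))"
  have "?A \<in> carrier_mat ?m ?m" by simp
  then have "det ?A = (\<Sum>p | p permutes {0..<?m}. signof p * (\<Prod>j<?m. ?A $$ (p j, j)))"
    by (rule det_col)
  also have "\<dots> = 0"
  proof (rule sum.neutral, clarify)
    fix p assume p: "p permutes {0..<?m}"
    have "k - l < ?m" using assms by auto
    moreover from this p have "p (k - l) < ?m" by (simp add: permutes_in_image)
    ultimately have "?A $$ (p (k - l), k - l) = 0"
      using assms by auto
    then have "(\<Prod>j<?m. ?A $$ (p j, j)) = 0"
      using \<open>k - l < ?m\<close> by (meson finite_lessThan lessThan_iff prod_zero)
    then show "signof p * (\<Prod>j<?m. ?A $$ (p j, j)) = 0" by simp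
  qed
  finally show ?thesis by (simp add: det_range_def)
qed

text \<open>Rows and columns of the zero block together number one more than the order of the
  matrix, so the bottom rows are supported on too few columns. Splitting before column
  \<open>k\<close> leaves a lower right block whose first column is zero.\<close>

lemma det_range_zero_block:
  fixes f :: "nat \<Rightarrow> nat \<Rightarrow> 'a :: idom"
  assumes "l \<le> k" "k \<le> u" and z: "\<And>i j. k \<le> i \<Longrightarrow> i \<le> u \<Longrightarrow> l \<le> j \<Longrightarrow> j \<le> k \<Longrightarrow> f i j = 0"
  shows "det_range l u f = 0"
proof (cases "k = l")
  case True
  then show ?thesis using assms by (intro det_range_zero_col[of _ k]) auto
next
  case False
  then have "det_range l u f = det_range l (k - 1) f * det_range (k - 1 + 1) u f"
    using assms by (intro det_range_block) auto
  moreover have "det_range (k - 1 + 1) u f = 0"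
    using assms False by (intro det_range_zero_col[of _ k]) auto
  ultimately show ?thesis by simp
qed

text \<open>Made for setting the last variable to 0, after which the last row is constant with at
  most one nonzero entry.\<close>

lemma det_range_last_row:
  assumes "\<And>j. j \<in> {1..n} \<Longrightarrow> f (Suc n) j = 0"
  shows "det_range 1 (Suc n) f = f (Suc n) (Suc n) * det_range 1 n f"
proof -
  let ?A = "mat (Suc n) (Suc n) (\<lambda>(i, j). f (1 + i) (1 + j))"
  let ?B1 = "mat n n (\<lambda>(j, i). f (1 + i) (1 + j))"
  let ?B3 = "mat 1 n (\<lambda>(j, i). f (1 + i) (Suc n))"
  let ?B4 = "mat 1 1 (\<lambda>(j, i). f (Suc n) (Suc n))"
  have "det ?A = det (transpose_mat ?A)"
    by (rule det_transpose[symmetric, of _ "Suc n"]) simp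
  also have "transpose_mat ?A = four_block_mat ?B1 (0\<^sub>m n 1) ?B3 ?B4"
    by (rule eq_matI) (auto simp: less_Suc_eq Suc_le_eq intro!: assms)
  also have "det \<dots> = det ?B1 * det ?B4"
    by (rule det_four_block_mat_upper_right_zero_col) auto
  also have "?B1 = transpose_mat (mat n n (\<lambda>(i, j). f (1 + i) (1 + j)))"
    by (rule eq_matI) auto
  also have "det \<dots> = det (mat n n (\<lambda>(i, j). f (1 + i) (1 + j)))"
    by (rule det_transpose[of _ n]) simp
  also have "det ?B4 = f (Suc n) (Suc n)"
    by (subst det_single) auto
  finally show ?thesis by (simp add: det_range_def mult.commute)
qed

section \<open>Alternants and divided differences\<close>

text \<open>
  \<open>divdiff S f\<close> is the divided difference of the univariate power series with coefficients \<open>f\<close> at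
  the variables indexed by \<open>S\<close> (0-based): the monomials \<open>x\<^sup>m\<close> contribute \<open>h\<^bsub>m - |S| + 1\<^esub>(x\<^sub>S)\<close>.
\<close>

definition divdiff :: "nat set \<Rightarrow> (nat \<Rightarrow> 'a) \<Rightarrow> 'a::zero mps" where
  "divdiff S f = Abs_mps (\<lambda>\<alpha>. if Poly_Mapping.keys \<alpha> \<subseteq> S then f (mdeg \<alpha> + card S - 1) else 0)"

lemma mcoeff_divdiff:
  "mcoeff (divdiff S f) \<alpha> = (if Poly_Mapping.keys \<alpha> \<subseteq> S then f (mdeg \<alpha> + card S - 1) else 0)"
  by (simp add: divdiff_def)

lemma mdeg_minus_single:
  "Poly_Mapping.lookup \<alpha> k \<noteq> 0 \<Longrightarrow> mdeg (\<alpha> - Poly_Mapping.single k 1) = mdeg \<alpha> - 1"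
proof -
  assume a: "Poly_Mapping.lookup \<alpha> k \<noteq> 0"
  have "(\<alpha> - Poly_Mapping.single k 1) + Poly_Mapping.single k 1 = \<alpha>"
    by (rule poly_mapping_eqI) (use a in \<open>auto simp: lookup_add lookup_minus lookup_single when_def\<close>)
  then have "mdeg \<alpha> = mdeg (\<alpha> - Poly_Mapping.single k 1) + 1"
    by (metis mdeg_plus mdeg_single)
  then show ?thesis by simp
qed

lemma mdeg_pos: "Poly_Mapping.lookup \<alpha> k \<noteq> 0 \<Longrightarrow> mdeg \<alpha> > 0"
  by (rule ccontr) (simp add: mdeg_def in_keys_iff)

lemma keys_minus_single_subset:
  assumes "k \<in> S" "Poly_Mapping.lookup \<alpha> k \<noteq> 0"
  shows "Poly_Mapping.keys (\<alpha> - Poly_Mapping.single k (1::nat)) \<subseteq> S \<longleftrightarrow> Poly_Mapping.keys \<alpha> \<subseteq> S"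
proof -
  have "Poly_Mapping.keys (\<alpha> - Poly_Mapping.single k 1) \<union> {k} = Poly_Mapping.keys \<alpha> \<union> {k}"
    by (auto simp: in_keys_iff lookup_minus lookup_single when_def split: if_splits)
  then show ?thesis using assms by blast
qed

text \<open>This is f[u,S] - f[v,S] = (x_u - x_v) f[u,v,S]. Every nonzero term has the same
  coefficient \<open>f (mdeg \<alpha> + card S)\<close> at \<alpha>, so only the conditions on which
  of the two variables occur in \<alpha> have to match.\<close>

lemma divdiff_step:
  assumes S: "finite S" "u \<notin> S" "v \<notin> S" "u \<noteq> v"
  shows "divdiff (insert u S) f =
    divdiff (insert v S) f + (xvar (Suc u) - xvar (Suc v)) * divdiff (insert u (insert v S)) (f :: nat \<Rightarrow> 'a :: comm_ring_1)"
proof (rule mps_eqI)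
  fix \<alpha>
  let ?T = "insert u (insert v S)"
  have c: "card ?T = card S + 2" "card (insert u S) = card S + 1" "card (insert v S) = card S + 1"
    using S by auto
  have x: "mcoeff (xvar (Suc w) * divdiff ?T f) \<alpha> =
      (if Poly_Mapping.lookup \<alpha> w \<noteq> 0 \<and> Poly_Mapping.keys \<alpha> \<subseteq> ?T then f (mdeg \<alpha> + card S) else 0)"
    if "w \<in> ?T" for w
    using keys_minus_single_subset[OF that, of \<alpha>] mdeg_minus_single[of \<alpha> w] mdeg_pos[of \<alpha> w]
    by (auto simp: mcoeff_xvar_mult mcoeff_divdiff c)
  have k: "Poly_Mapping.keys \<alpha> \<subseteq> insert u S \<longleftrightarrow> Poly_Mapping.keys \<alpha> \<subseteq> ?T \<and> Poly_Mapping.lookup \<alpha> v = 0"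
    "Poly_Mapping.keys \<alpha> \<subseteq> insert v S \<longleftrightarrow> Poly_Mapping.keys \<alpha> \<subseteq> ?T \<and> Poly_Mapping.lookup \<alpha> u = 0"
    using S by (auto simp: subset_iff in_keys_iff) (metis less_irrefl)+
  have d: "mcoeff (divdiff (insert u S) f) \<alpha> =
      (if Poly_Mapping.keys \<alpha> \<subseteq> ?T \<and> Poly_Mapping.lookup \<alpha> v = 0 then f (mdeg \<alpha> + card S) else 0)"
    "mcoeff (divdiff (insert v S) f) \<alpha> =
      (if Poly_Mapping.keys \<alpha> \<subseteq> ?T \<and> Poly_Mapping.lookup \<alpha> u = 0 then f (mdeg \<alpha> + card S) else 0)"
    unfolding mcoeff_divdiff k c by auto
  show "mcoeff (divdiff (insert u S) f) \<alpha> = mcoeff (divdiff (insert v S) f +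
      (xvar (Suc u) - xvar (Suc v)) * divdiff ?T f) \<alpha>"
    unfolding mcoeff_simps left_diff_distrib d by (subst (1 2) x) auto
qed

text \<open>Newton interpolation with the nodes taken in the order n - 1, n - 2, ..., evaluated at
  node i: terms with k < i would contain the factor x_i - x_i, so the sum ends at i.\<close>

lemma newton_interpolation:
  fixes f :: "nat \<Rightarrow> 'a :: comm_ring_1"
  assumes "i < n"
  shows "divdiff {i} f =
    (\<Sum>k = i..<n. (\<Prod>l = Suc k..<n. xvar (Suc i) - xvar (Suc l)) * divdiff {k..<n} f)"
proof -
  let ?p = "\<lambda>k. (\<Prod>l = Suc k..<n. xvar (Suc i) - xvar (Suc l)) :: 'a mps"
  \<comment> \<open>Newton's formula with remainder after the nodes above m, starting from m = n - 1
    and working down; at m = i the remainder is the missing term k = i.\<close>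
  have "divdiff {i} f = ?p m * divdiff (insert i {Suc m..<n}) f + (\<Sum>k = Suc m..<n. ?p k * divdiff {k..<n} f)"
    if "i \<le> m" "m < n" for m
    using that(2,1)
  proof (induction "n - m" arbitrary: m)
    case 0
    then show ?case by simp
  next
    case (Suc t)
    show ?case
    proof (cases "Suc m = n")
      case True
      then show ?thesis by simp
    next
      case False
      then have lt: "Suc m < n" using Suc.prems by simp
      have eq: "{Suc m..<n} = insert (Suc m) {Suc (Suc m)..<n}" using lt by auto
      have "divdiff {i} f = ?p (Suc m) * divdiff (insert i {Suc (Suc m)..<n}) f
          + (\<Sum>k = Suc (Suc m)..<n. ?p k * divdiff {k..<n} f)"
        using Suc lt by auto
      also have "divdiff (insert i {Suc (Suc m)..<n}) f =
          divdiff {Suc m..<n} f + (xvar (Suc i) - xvar (Suc (Suc m))) * divdiff (insert i {Suc m..<n}) f"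
        unfolding eq by (rule divdiff_step) (use Suc.prems in auto)
      also have "?p (Suc m) * \<dots> + (\<Sum>k = Suc (Suc m)..<n. ?p k * divdiff {k..<n} f) =
          ?p m * divdiff (insert i {Suc m..<n}) f + (\<Sum>k = Suc m..<n. ?p k * divdiff {k..<n} f)"
        using lt by (simp add: sum.atLeast_Suc_lessThan[of "Suc m"] prod.atLeast_Suc_lessThan[of "Suc m"] algebra_simps)
      finally show ?thesis .
    qed
  qed
  moreover have "insert i {Suc i..<n} = {i..<n}" using assms by auto
  ultimately show ?thesis
    using assms sum.atLeast_Suc_lessThan[of i n "\<lambda>k. ?p k * divdiff {k..<n} f"] by fastforce
qed

section \<open>Division of an alternant by the Vandermonde product\<close>

lemma vandermonde_eq: "vandermonde n = (\<Prod>k = 0..<n. \<Prod>l = Suc k..<n. xvar (Suc k) - xvar (Suc l))"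
proof -
  have "vandermonde n = (\<Prod>(k, l) \<in> (SIGMA k:{0..<n}. {Suc k..<n}). xvar (Suc k) - xvar (Suc l))"
    unfolding vandermonde_def
    by (rule prod.reindex_bij_witness[where i = "\<lambda>(k, l). (Suc k, Suc l)" and j = "\<lambda>(k, l). (k - 1, l - 1)"])
      auto
  then show ?thesis by (simp add: prod.Sigma)
qed

text \<open>Newton interpolation read as a matrix product. The left factor is upper triangular and
  its diagonal entries multiply to the Vandermonde product.\<close>

lemma alternant_eq_vandermonde_mult:
  "det_range 1 n (\<lambda>i j. divdiff {i - 1} (f j)) = det_range 1 n (\<lambda>i j. divdiff {i - 1..<n} (f j)) * vandermonde n"
proof -
  let ?L = "mat n n (\<lambda>(i, k). if i \<le> k then \<Prod>l = Suc k..<n. xvar (Suc i) - xvar (Suc l) else 0) :: qa mps mat"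
  let ?R = "mat n n (\<lambda>(k, j). divdiff {k..<n} (f (Suc j)))"
  have "mat n n (\<lambda>(i, j). divdiff {i} (f (Suc j))) = ?L * ?R"
  proof (rule eq_matI)
    fix i j assume "i < dim_row (?L * ?R)" "j < dim_col (?L * ?R)"
    then have ij: "i < n" "j < n" by auto
    have "(?L * ?R) $$ (i, j) = (\<Sum>k = 0..<n. (if i \<le> k then
        (\<Prod>l = Suc k..<n. xvar (Suc i) - xvar (Suc l)) else 0) * divdiff {k..<n} (f (Suc j)))"
      using ij by (simp add: scalar_prod_def)
    also have "\<dots> = (\<Sum>k = i..<n. (\<Prod>l = Suc k..<n. xvar (Suc i) - xvar (Suc l)) * divdiff {k..<n} (f (Suc j)))"
      by (rule sum.mono_neutral_cong_right) auto
    finally show "mat n n (\<lambda>(i, j). divdiff {i} (f (Suc j))) $$ (i, j) = (?L * ?R) $$ (i, j)"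
      using ij newton_interpolation[OF ij(1)] by simp
  qed auto
  then have "det_range 1 n (\<lambda>i j. divdiff {i - 1} (f j)) = det ?L * det_range 1 n (\<lambda>i j. divdiff {i - 1..<n} (f j))"
    by (simp add: det_range_def det_mult[of _ n])
  also have "det ?L = vandermonde n"
    by (subst det_upper_triangular[of _ n])
      (auto simp: upper_triangular_def prod_list_diag_prod vandermonde_eq)
  finally show ?thesis by (simp add: mult.commute)
qed

text \<open>Comparing coefficients at \<alpha> times the i-th variable shows that the coefficient of
  \<open>Q\<close> at \<alpha> is unchanged when one factor j is traded for a factor i, and is 0 if
  j does not occur. Induction on the exponent of j finishes.\<close>

lemma xvar_diff_mult_eq_0:
  fixes Q :: "'a :: comm_ring_1 mps"
  assumes ij: "i \<noteq> j" and z: "(xvar (Suc i) - xvar (Suc j)) * Q = 0"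
  shows "Q = 0"
proof (rule mps_eqI)
  fix \<alpha>
  let ?s = "\<lambda>k. Poly_Mapping.single k (1::nat)"
  have "mcoeff Q \<alpha> = 0" if "Poly_Mapping.lookup \<alpha> j = m" for m
    using that
  proof (induction m arbitrary: \<alpha>)
    case 0
    have "mcoeff ((xvar (Suc i) - xvar (Suc j)) * Q) (\<alpha> + ?s i) = 0"
      by (simp only: z mcoeff_simps)
    then show ?case
      using ij 0 by (simp add: left_diff_distrib mcoeff_xvar_mult lookup_add lookup_single when_def)
  next
    case (Suc m)
    have "mcoeff ((xvar (Suc i) - xvar (Suc j)) * Q) (\<alpha> + ?s i) = 0"
      by (simp only: z mcoeff_simps)
    then have "mcoeff Q \<alpha> = mcoeff Q (\<alpha> + ?s i - ?s j)"
      using ij Suc.prems by (simp add: left_diff_distrib mcoeff_xvar_mult lookup_add lookup_single when_def)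
    also have "\<dots> = 0"
      using ij Suc.prems by (intro Suc.IH) (simp add: lookup_add lookup_minus lookup_single when_def)
    finally show ?case .
  qed
  then show "mcoeff Q \<alpha> = mcoeff 0 \<alpha>" by simp
qed

text \<open>Gives the uniqueness on which the \<open>THE\<close> in \<open>mps_quot\<close> rests;
  linear factors are cancelled one at a time.\<close>

lemma vandermonde_mult_eq_0:
  assumes "Q * vandermonde n = 0"
  shows "Q = 0"
proof -
  \<comment> \<open>Generalised to any finite set of factors, so that induction can remove a single
    one.\<close>
  have "Q = 0" if "finite A" "A \<subseteq> {(i, j). 1 \<le> i \<and> i < j}" "Q * (\<Prod>(i, j)\<in>A. xvar i - xvar j) = 0"
    for A :: "(nat \<times> nat) set" and Q :: "qa mps"
    using that
  proof (induction A arbitrary: Q rule: finite_induct)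
    case (insert p A)
    obtain a b where "p = (a, b)" "1 \<le> a" "a < b"
      using insert.prems(1) by (cases p) auto
    then obtain i j where p: "p = (Suc i, Suc j)" "i \<noteq> j"
      by (cases a; cases b) auto
    have "(Q * (xvar (Suc i) - xvar (Suc j))) * (\<Prod>(i, j)\<in>A. xvar i - xvar j) = 0"
      using insert by (simp add: p mult.assoc)
    then have "Q * (xvar (Suc i) - xvar (Suc j)) = 0"
      using insert by auto
    then show ?case
      using xvar_diff_mult_eq_0[OF p(2), of Q] by (simp add: mult.commute)
  qed simp
  note zero_product = this
  have "finite {(i, j). 1 \<le> i \<and> i < j \<and> j \<le> n}"
    by (rule finite_subset[of _ "{..n} \<times> {..n}"]) auto
  then show ?thesis
    by (intro zero_product[OF _ _ assms[unfolded vandermonde_def]]) auto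
qed

lemma mps_quot_alternant:
  "mps_quot (det_range 1 n (\<lambda>i j. divdiff {i - 1} (f j))) (vandermonde n) =
    det_range 1 n (\<lambda>i j. divdiff {i - 1..<n} (f j))"
  unfolding mps_quot_def
proof (rule the_equality)
  fix Q assume "Q * vandermonde n = det_range 1 n (\<lambda>i j. divdiff {i - 1} (f j))"
  then have "(Q - det_range 1 n (\<lambda>i j. divdiff {i - 1..<n} (f j))) * vandermonde n = 0"
    unfolding alternant_eq_vandermonde_mult by (simp add: left_diff_distrib)
  then show "Q = det_range 1 n (\<lambda>i j. divdiff {i - 1..<n} (f j))"
    using vandermonde_mult_eq_0 by fastforce
qed (rule alternant_eq_vandermonde_mult[symmetric])

section \<open>Elementary and complete symmetric polynomials\<close>

lemma elem_sym_neg [simp]: "k < 0 \<Longrightarrow> elem_sym k A = 0"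
  by (simp add: elem_sym_def)

lemma compl_sym_neg [simp]: "k < 0 \<Longrightarrow> compl_sym k A = 0"
  by (simp add: compl_sym_def)

lemma elem_sym_gt_card: "finite A \<Longrightarrow> k > int (card A) \<Longrightarrow> elem_sym k A = 0"
proof -
  assume fin: "finite A" and "k > int (card A)"
  then have "{T. T \<subseteq> A \<and> card T = nat k} = {}"
    by (auto dest!: card_mono[OF fin])
  then show "elem_sym k A = 0" by (simp only: elem_sym_def) simp
qed

lemma elem_sym_empty: "elem_sym k {} = (if k = 0 then 1 else 0)"
proof -
  have "{T :: int set. T \<subseteq> {} \<and> card T = nat k} = (if k \<le> 0 then {{}} else {})"
    by auto
  then show ?thesis by (auto simp: elem_sym_def)
qed

lemma compl_sym_empty: "compl_sym k {} = (if k = 0 then 1 else 0)"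
proof -
  have "{M :: int multiset. set_mset M \<subseteq> {} \<and> size M = nat k} = (if k \<le> 0 then {{#}} else {})"
    by auto
  then show ?thesis by (auto simp: compl_sym_def)
qed

lemma elem_sym_0: "finite A \<Longrightarrow> elem_sym 0 A = 1"
proof -
  assume "finite A"
  then have "{T. T \<subseteq> A \<and> card T = nat 0} = {{}}"
    by (auto dest: finite_subset)
  then show ?thesis by (simp add: elem_sym_def)
qed

lemma compl_sym_0: "compl_sym 0 A = 1"
proof -
  have "{M. set_mset M \<subseteq> A \<and> size M = nat 0} = {{#}}" by auto
  then show ?thesis by (simp add: compl_sym_def)
qed

text \<open>Splits the subsets by whether they contain \<open>y\<close>.\<close>

lemma elem_sym_insert:
  assumes "finite A" "y \<notin> A"
  shows "elem_sym k (insert y A) = elem_sym k A + avar y * elem_sym (k - 1) A"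
proof (cases "k \<le> 0")
  case True
  then show ?thesis using assms by (cases "k = 0") (auto simp: elem_sym_0)
next
  case False
  then obtain j where k: "k = int j + 1"
    by (metis add.commute nat_int not_le zless_iff_Suc_zadd add_0 of_nat_Suc)
  let ?F = "\<lambda>j. {T. T \<subseteq> A \<and> card T = j}"
  have fin: "finite (?F j)" for j using assms by (auto intro: finite_subset[of _ "Pow A"])
  have card_ins: "card (insert y T) = Suc (card T)" if "T \<subseteq> A" for T
    by (rule card_insert_disjoint) (use that assms finite_subset in auto)
  have "{T. T \<subseteq> insert y A \<and> card T = Suc j} = ?F (Suc j) \<union> insert y ` ?F j"
  proof (intro equalityI subsetI)
    fix T assume T: "T \<in> {T. T \<subseteq> insert y A \<and> card T = Suc j}"
    show "T \<in> ?F (Suc j) \<union> insert y ` ?F j"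
    proof (cases "y \<in> T")
      case True
      then have "T = insert y (T - {y})" "T - {y} \<in> ?F j"
        using T by (auto simp: card_Diff_singleton_if)
      then show ?thesis by blast
    qed (use T in auto)
  next
    fix T assume "T \<in> ?F (Suc j) \<union> insert y ` ?F j"
    then show "T \<in> {T. T \<subseteq> insert y A \<and> card T = Suc j}"
      using card_ins by auto
  qed
  then have "elem_sym k (insert y A) =
      (\<Sum>T\<in>?F (Suc j). \<Prod>i\<in>T. avar i) + (\<Sum>T\<in>insert y ` ?F j. \<Prod>i\<in>T. avar i)"
    using fin assms(2) by (simp add: elem_sym_def k nat_add_distrib) (subst sum.union_disjoint, auto)
  also have "(\<Sum>T\<in>insert y ` ?F j. \<Prod>i\<in>T. avar i) = (\<Sum>T\<in>?F j. \<Prod>i\<in>insert y T. avar i)"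
  proof (subst sum.reindex)
    show "inj_on (insert y) (?F j)"
      by (rule inj_on_inverseI[where g = "\<lambda>T. T - {y}"]) (use assms(2) in auto)
  qed (simp add: comp_def)
  also have "\<dots> = (\<Sum>T\<in>?F j. avar y * (\<Prod>i\<in>T. avar i))"
    using assms by (intro sum.cong) (auto intro!: prod.insert dest: finite_subset)
  finally show ?thesis
    by (simp add: elem_sym_def k nat_add_distrib sum_distrib_left)
qed

text \<open>A multiset containing \<open>y\<close> loses one copy and may keep others, hence
  \<open>insert y A\<close> also in the last term.\<close>

lemma compl_sym_insert:
  assumes "finite A" "y \<notin> A"
  shows "compl_sym k (insert y A) = compl_sym k A + avar y * compl_sym (k - 1) (insert y A)"
proof (cases "k \<le> 0")
  case True
  then show ?thesis by (cases "k = 0") (auto simp: compl_sym_0)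
next
  case False
  then obtain j where k: "k = int j + 1"
    by (metis add.commute nat_int not_le zless_iff_Suc_zadd add_0 of_nat_Suc)
  let ?F = "\<lambda>B j. {M. set_mset M \<subseteq> B \<and> size M = j}"
  have fin: "finite (?F B j)" if "finite B" for B :: "int set" and j
    using finite_multisets_of_size[OF that, of j] by (simp add: multisets_of_size_def)
  have "?F (insert y A) (Suc j) = ?F A (Suc j) \<union> add_mset y ` ?F (insert y A) j"
  proof (intro equalityI subsetI)
    fix M assume M: "M \<in> ?F (insert y A) (Suc j)"
    show "M \<in> ?F A (Suc j) \<union> add_mset y ` ?F (insert y A) j"
    proof (cases "y \<in># M")
      case True
      then have "M = add_mset y (M - {#y#})" "M - {#y#} \<in> ?F (insert y A) j"
        using M by (auto simp: size_Diff_singleton dest: in_diffD)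
      then show ?thesis by blast
    qed (use M in auto)
  qed auto
  then have "compl_sym k (insert y A) =
      (\<Sum>M\<in>?F A (Suc j). \<Prod>i\<in>#M. avar i) + (\<Sum>M\<in>add_mset y ` ?F (insert y A) j. \<Prod>i\<in>#M. avar i)"
    using fin[of A] fin[of "insert y A"] assms
    by (simp add: compl_sym_def k nat_add_distrib) (subst sum.union_disjoint, auto)
  also have "(\<Sum>M\<in>add_mset y ` ?F (insert y A) j. \<Prod>i\<in>#M. avar i) = (\<Sum>M\<in>?F (insert y A) j. avar y * (\<Prod>i\<in>#M. avar i))"
    by (subst sum.reindex) (auto simp: inj_on_def)
  finally show ?thesis
    by (simp add: compl_sym_def k nat_add_distrib sum_distrib_left)
qed

text \<open>
  The recurrences of the two matrices in \<open>t\<close> cancel except for a shift of both outer indices, so the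
  sum for \<open>(k, m)\<close> reduces to the sum for \<open>(k - 1, m - 1)\<close>.
\<close>

lemma elem_compl_orthogonal:
  fixes y :: "nat \<Rightarrow> int"
  assumes y: "inj y" and "k \<le> K"
  shows "(\<Sum>t\<le>K. (-1) ^ (t + m) * elem_sym (int t - int m) (y ` {..<t}) *
      compl_sym (int k - int t) (y ` {..<Suc t})) = (if k = m then 1 else 0)"
proof -
  define E where "E t m = (-1) ^ (t + m) * elem_sym (int t - int m) (y ` {..<t})" for t m :: nat
  define c where "c t k = compl_sym (int k - int t) (y ` {..<Suc t})" for t k :: nat
  let ?a = "\<lambda>t. avar (y t)"
  have ins: "y ` {..<Suc t} = insert (y t) (y ` {..<t})" "y t \<notin> y ` {..<t}" for t
    using y by (auto simp: lessThan_Suc dest: injD)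
  have E_Suc: "E (Suc t) (Suc m) = E t m - ?a t * E t (Suc m)" for t m
    unfolding E_def ins(1) by (subst elem_sym_insert) (auto simp: ins algebra_simps)
  \<comment> \<open>For \<open>m = 0\<close> one term of the recurrence is e_{t+1} in t variables,
    which vanishes.\<close>
  have E_Suc_0: "E (Suc t) 0 = - ?a t * E t 0" for t
    unfolding E_def ins(1)
    by (subst elem_sym_insert) (auto simp: ins elem_sym_gt_card card_image inj_on_subset[OF y] algebra_simps)
  have E_0: "E 0 m = (if m = 0 then 1 else 0)" for m
    by (simp add: E_def elem_sym_empty)
  have c_Suc: "c (Suc t) (Suc k) = c t k + ?a (Suc t) * c (Suc t) k" for t k
    unfolding c_def ins(1)[of "Suc t"] by (subst compl_sym_insert) (auto simp: ins(2) algebra_simps)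
  have c_0_Suc: "c 0 (Suc k) = ?a 0 * c 0 k" for k
    unfolding c_def ins(1) by (subst compl_sym_insert) (auto simp: compl_sym_empty algebra_simps)
  have c_lt: "c t k = 0" if "k < t" for t k
    using that by (simp add: c_def)
  have "(\<Sum>t\<le>K. E t m * c t k) = (if k = m then 1 else 0)"
    using \<open>k \<le> K\<close>
  proof (induction k arbitrary: m)
    case 0
    have "(\<Sum>t\<le>K. E t m * c t 0) = (\<Sum>t\<in>{0}. E t m * c t 0)"
      by (rule sum.mono_neutral_right) (auto simp: c_lt)
    then show ?case by (simp add: E_0 c_def compl_sym_0)
  next
    case (Suc k)
    \<comment> \<open>Adding or dropping the term t = K is therefore free, which aligns the ranges
      of the two shifted sums.\<close>
    have cK: "c K k = 0" using Suc.prems by (simp add: c_lt)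
    obtain K' where K': "K = Suc K'" using Suc.prems by (cases K) auto
    have "(\<Sum>t\<le>K. E t m * c t (Suc k)) = E 0 m * c 0 (Suc k) + (\<Sum>t\<le>K'. E (Suc t) m * c (Suc t) (Suc k))"
      unfolding K' by (rule sum.atMost_Suc_shift)
    also have "\<dots> = (E 0 m * (?a 0 * c 0 k) + (\<Sum>t\<le>K'. E (Suc t) m * (?a (Suc t) * c (Suc t) k)))
        + (\<Sum>t\<le>K'. E (Suc t) m * c t k)"
      by (simp add: c_Suc c_0_Suc distrib_left sum.distrib)
    also have "E 0 m * (?a 0 * c 0 k) + (\<Sum>t\<le>K'. E (Suc t) m * (?a (Suc t) * c (Suc t) k))
        = (\<Sum>t\<le>K. E t m * (?a t * c t k))"
      unfolding K' by (rule sum.atMost_Suc_shift[symmetric])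
    also have "\<dots> = (\<Sum>t\<le>K'. E t m * (?a t * c t k))"
      using cK by (simp add: K')
    also have "\<dots> + (\<Sum>t\<le>K'. E (Suc t) m * c t k) = (\<Sum>t\<le>K'. (E t m * ?a t + E (Suc t) m) * c t k)"
      by (simp add: sum.distrib distrib_right mult.assoc)
    \<comment> \<open>The factor in front of \<open>c t k\<close> is 0 for m = 0 by
      \<open>E_Suc_0\<close>, and \<open>E t (m - 1)\<close> otherwise by
      \<open>E_Suc\<close>.\<close>
    also have "\<dots> = (if Suc k = m then 1 else 0)"
    proof (cases m)
      case 0
      then show ?thesis by (simp add: E_Suc_0 mult.commute)
    next
      case (Suc m')
      have "(\<Sum>t\<le>K'. (E t m * ?a t + E (Suc t) m) * c t k) = (\<Sum>t\<le>K. E t m' * c t k)"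
        using cK by (simp add: Suc E_Suc K' mult.commute)
      then show ?thesis using Suc.IH[of m'] Suc.prems Suc by simp
    qed
    finally show ?case .
  qed
  then show ?thesis unfolding E_def c_def .
qed

section \<open>Coefficients of the dual columns\<close>

text \<open>
  Column \<open>j\<close> of the numerator of the dual Schur polynomial of \<open>\<lambda>\<close> depends only on \<open>t = \<lambda>\<^sub>j - j\<close>: up to the factor
  \<open>x\<^sup>n\<close> it is the Laurent series in which \<open>x\<^sup>k\<close> has coefficient \<open>dual_coeff t k\<close>.
\<close>

definition dual_coeff :: "int \<Rightarrow> int \<Rightarrow> qa" where
  "dual_coeff t k =
     (if t \<ge> 0 then compl_sym (k - t) {-t..0}
      else (-1) ^ nat (k - t) * elem_sym (k - t) {1..-t - 1})"

text \<open>Coefficient of the series \<open>dual_coeff t\<close> in the expansion of the monomial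
  x^m. Mixed signs give 0 because the series with t >= 0 contain only nonnegative exponents and
  those with t < 0 only negative ones.\<close>

definition dual_coeff_inv :: "int \<Rightarrow> int \<Rightarrow> qa" where
  "dual_coeff_inv t m =
     (if t \<ge> 0 \<and> m \<ge> 0 then (-1) ^ nat (t - m) * elem_sym (t - m) {-t + 1..0}
      else if t < 0 \<and> m < 0 then compl_sym (t - m) {1..-t} else 0)"

lemma dual_coeff_lt: "k < t \<Longrightarrow> dual_coeff t k = 0"
  by (simp add: dual_coeff_def)

lemma dual_coeff_same: "dual_coeff t t = 1"
  by (simp add: dual_coeff_def elem_sym_0 compl_sym_0)

lemma dual_coeff_inv_lt: "t < m \<Longrightarrow> dual_coeff_inv t m = 0"
  by (simp add: dual_coeff_inv_def)

text \<open>For \<open>t < m\<close> both sides vanish; otherwise difference and sum have the same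
  parity.\<close>

lemma sign_elem_sym:
  "(-1) ^ (t + m) * elem_sym (int t - int m) A = (-1) ^ nat (int t - int m) * elem_sym (int t - int m) A"
proof (cases "t < m")
  case False
  then have "even (nat (int t - int m)) \<longleftrightarrow> even (t + m)" by (simp add: nat_diff_distrib)
  then show ?thesis by (simp add: minus_one_power_iff)
qed simp

lemma dual_coeff_orthogonal_nonneg:
  assumes "k < int K"
  shows "(\<Sum>t = 0..<int K. dual_coeff_inv t m * dual_coeff t k) = (if k = m \<and> m \<ge> 0 then 1 else 0)"
proof (cases "k \<ge> 0 \<and> m \<ge> 0")
  case True
  then obtain k' m' K' where k: "k = int k'" "m = int m'" "K = Suc K'" "k' \<le> K'"
    using assms that[of "nat k" "nat m" "K - 1"] by (cases K) auto
  \<comment> \<open>Enumerates a_0, a_{-1}, ... so that the first t variables have indices -t + 1,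
    ..., 0.\<close>
  define y :: "nat \<Rightarrow> int" where "y i = - int i" for i
  have y: "inj y" by (auto simp: y_def inj_def)
  have im: "y ` {..<t} = {- int t + 1..0}" for t
  proof -
    have "x \<in> y ` {..<t}" if "x \<in> {- int t + 1..0}" for x
      using that by (intro image_eqI[of _ _ "nat (- x)"]) (auto simp: y_def)
    then show ?thesis by (auto simp: y_def)
  qed
  have "(\<Sum>t = 0..<int K. dual_coeff_inv t m * dual_coeff t k) =
      (\<Sum>t\<le>K'. dual_coeff_inv (int t) m * dual_coeff (int t) k)"
    by (rule sum.reindex_bij_witness[where i = int and j = nat]) (auto simp: k)
  also have "\<dots> = (\<Sum>t\<le>K'. (-1) ^ (t + m') * elem_sym (int t - int m') (y ` {..<t}) *
      compl_sym (int k' - int t) (y ` {..<Suc t}))"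
  proof (rule sum.cong[OF refl])
    fix t
    show "dual_coeff_inv (int t) m * dual_coeff (int t) k =
        (-1) ^ (t + m') * elem_sym (int t - int m') (y ` {..<t}) * compl_sym (int k' - int t) (y ` {..<Suc t})"
      unfolding im sign_elem_sym by (simp add: dual_coeff_inv_def dual_coeff_def k)
  qed
  also have "\<dots> = (if k' = m' then 1 else 0)"
    by (rule elem_compl_orthogonal[OF y k(4)])
  finally show ?thesis by (simp add: k)
next
  case False
  then show ?thesis
    by (auto intro!: sum.neutral simp: dual_coeff_inv_def dual_coeff_lt)
qed

text \<open>After the reflection t = -u - 1 the elementary factor sits in \<open>dual_coeff\<close>
  and the complete one in \<open>dual_coeff_inv\<close>, so \<open>elem_compl_orthogonal\<close> is
  used with its outer indices interchanged.\<close>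

lemma dual_coeff_orthogonal_neg:
  assumes "- int n \<le> m"
  shows "(\<Sum>t = - int n..<0. dual_coeff_inv t m * dual_coeff t k) = (if k = m \<and> m < 0 then 1 else 0)"
proof (cases "k < 0 \<and> m < 0")
  case True
  define k' m' where "k' = nat (- k - 1)" and "m' = nat (- m - 1)"
  then obtain n' where k: "k = - int k' - 1" "m = - int m' - 1" "n = Suc n'" "m' \<le> n'"
    using assms True by (cases n) auto
  define y :: "nat \<Rightarrow> int" where "y i = int i + 1" for i
  have y: "inj y" by (auto simp: y_def inj_def)
  have im: "y ` {..<t} = {1..int t}" for t
  proof -
    have "x \<in> y ` {..<t}" if "x \<in> {1..int t}" for x
      using that by (intro image_eqI[of _ _ "nat (x - 1)"]) (auto simp: y_def)
    then show ?thesis by (auto simp: y_def)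
  qed
  have "(\<Sum>t = - int n..<0. dual_coeff_inv t m * dual_coeff t k) =
      (\<Sum>u\<le>n'. dual_coeff_inv (- int u - 1) m * dual_coeff (- int u - 1) k)"
    by (rule sum.reindex_bij_witness[where i = "\<lambda>u. - int u - 1" and j = "\<lambda>t. nat (- t - 1)"]) (auto simp: k)
  also have "\<dots> = (\<Sum>u\<le>n'. (-1) ^ (u + k') * elem_sym (int u - int k') (y ` {..<u}) *
      compl_sym (int m' - int u) (y ` {..<Suc u}))"
  proof (rule sum.cong[OF refl])
    fix u
    show "dual_coeff_inv (- int u - 1) m * dual_coeff (- int u - 1) k =
        (-1) ^ (u + k') * elem_sym (int u - int k') (y ` {..<u}) * compl_sym (int m' - int u) (y ` {..<Suc u})"
      unfolding im sign_elem_sym by (simp add: dual_coeff_inv_def dual_coeff_def k algebra_simps)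
  qed
  also have "\<dots> = (if m' = k' then 1 else 0)"
    by (rule elem_compl_orthogonal[OF y k(4)])
  finally show ?thesis by (auto simp: k)
next
  case False
  \<comment> \<open>The degree k - t exceeds the number -t - 1 of variables.\<close>
  have "dual_coeff t k = 0" if "t < 0" "k \<ge> 0" for t
    using that by (simp add: dual_coeff_def elem_sym_gt_card)
  then show ?thesis using False
    by (auto intro!: sum.neutral simp: dual_coeff_inv_def)
qed

text \<open>The expansion of x^m in the dual columns. The truncation is exact:
  \<open>dual_coeff_inv t m\<close> vanishes for t < -n and \<open>dual_coeff t k\<close> for t >=
  K.\<close>

lemma dual_coeff_orthogonal:
  assumes "- int n \<le> m" "k < int K"
  shows "(\<Sum>t = - int n..<int K. dual_coeff_inv t m * dual_coeff t k) = (if k = m then 1 else 0)"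
proof -
  have "{- int n..<int K} = {- int n..<0} \<union> {0..<int K}" by auto
  then have "(\<Sum>t = - int n..<int K. dual_coeff_inv t m * dual_coeff t k) =
      (\<Sum>t = - int n..<0. dual_coeff_inv t m * dual_coeff t k) + (\<Sum>t = 0..<int K. dual_coeff_inv t m * dual_coeff t k)"
    by (simp add: sum.union_disjoint)
  then show ?thesis
    using assms by (auto simp: dual_coeff_orthogonal_neg dual_coeff_orthogonal_nonneg)
qed

section \<open>Dual Schur functions as determinants of divided differences\<close>

text \<open>With a single node the divided difference is the univariate series itself, so a factor x
  shifts its coefficients.\<close>

lemma xvar_mult_divdiff:
  "xvar (Suc i) * divdiff {i} f = divdiff {i} (\<lambda>m. if m = 0 then 0 else f (m - 1) :: 'a :: comm_ring_1)"
proof (rule mps_eqI)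
  fix \<alpha> :: "nat \<Rightarrow>\<^sub>0 nat"
  have "mdeg \<alpha> = Poly_Mapping.lookup \<alpha> i" if "Poly_Mapping.keys \<alpha> \<subseteq> {i}"
    using mdeg_superset[OF _ that] by simp
  then show "mcoeff (xvar (Suc i) * divdiff {i} f) \<alpha> =
      mcoeff (divdiff {i} (\<lambda>m. if m = 0 then 0 else f (m - 1))) \<alpha>"
    using keys_minus_single_subset[of i "{i}" \<alpha>] mdeg_minus_single[of \<alpha> i]
    by (auto simp: mcoeff_xvar_mult mcoeff_divdiff)
qed

lemma xvar_power: "xvar (Suc i) ^ p = divdiff {i} (\<lambda>m. if m = p then 1 else 0 :: 'a :: comm_ring_1)"
proof (induction p)
  case 0
  have "mdeg \<alpha> = 0 \<longleftrightarrow> \<alpha> = 0" for \<alpha> :: "nat \<Rightarrow>\<^sub>0 nat"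
    by (auto simp: mdeg_def in_keys_iff intro!: poly_mapping_eqI)
  then show ?case by (auto intro!: mps_eqI simp: mcoeff_one mcoeff_divdiff)
next
  case (Suc p)
  then show ?case by (auto simp: xvar_mult_divdiff fun_eq_iff intro!: arg_cong[where f = "divdiff {i}"])
qed

lemma one_minus_xvar_mult_divdiff:
  "(1 - mps_const c * xvar (Suc i)) * divdiff {i} f =
    divdiff {i} (\<lambda>m. f m - (if m = 0 then 0 else c * f (m - 1)) :: 'a :: comm_ring_1)"
  by (rule mps_eqI)
    (simp add: left_diff_distrib mult.assoc xvar_mult_divdiff mcoeff_const_mult mcoeff_divdiff)

text \<open>The generating function of the complete symmetric polynomials, multiplied out to avoid a
  quotient; each linear factor removes one variable by \<open>compl_sym_insert\<close>.\<close>

lemma prod_mult_divdiff_compl_sym: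
  assumes "finite A"
  shows "(\<Prod>k\<in>A. 1 - mps_const (avar k) * xvar (Suc i)) *
      divdiff {i} (\<lambda>m. compl_sym (int m - int p) A) = xvar (Suc i) ^ p"
  using assms
proof (induction A rule: finite_induct)
  case empty
  then show ?case by (simp add: compl_sym_empty xvar_power)
next
  case (insert y A)
  have "(1 - mps_const (avar y) * xvar (Suc i)) * divdiff {i} (\<lambda>m. compl_sym (int m - int p) (insert y A))
      = divdiff {i} (\<lambda>m. compl_sym (int m - int p) A)"
    unfolding one_minus_xvar_mult_divdiff
  proof (intro arg_cong[where f = "divdiff {i}"] ext)
    fix m
    show "compl_sym (int m - int p) (insert y A) -
        (if m = 0 then 0 else avar y * compl_sym (int (m - 1) - int p) (insert y A)) = compl_sym (int m - int p) A"
      by (subst compl_sym_insert[OF insert(1,2)]) (auto simp: of_nat_diff algebra_simps)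
  qed
  then show ?case using insert by (simp add: mult.assoc mult.left_commute[of "1 - _"])
qed

lemma xvar_power_mult_prod:
  assumes "finite A"
  shows "xvar (Suc i) ^ p * (\<Prod>k\<in>A. 1 - mps_const (avar k) * xvar (Suc i)) =
      divdiff {i} (\<lambda>m. (-1) ^ nat (int m - int p) * elem_sym (int m - int p) A)"
  using assms
proof (induction A rule: finite_induct)
  case empty
  then show ?case
    by (auto simp: elem_sym_empty xvar_power intro!: arg_cong[where f = "divdiff {i}"])
next
  case (insert y A)
  let ?f = "\<lambda>A m. (-1) ^ nat (int m - int p) * elem_sym (int m - int p) A"
  have "xvar (Suc i) ^ p * (\<Prod>k\<in>insert y A. 1 - mps_const (avar k) * xvar (Suc i)) =
      (1 - mps_const (avar y) * xvar (Suc i)) * divdiff {i} (?f A)"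
    using insert by (simp add: mult.left_commute[of "xvar (Suc i) ^ p"])
  also have "\<dots> = divdiff {i} (?f (insert y A))"
    unfolding one_minus_xvar_mult_divdiff
  proof (intro arg_cong[where f = "divdiff {i}"] ext)
    fix m
    show "?f A m - (if m = 0 then 0 else avar y * ?f A (m - 1)) = ?f (insert y A) m"
    \<comment> \<open>For m <= p the shifted term has negative degree and vanishes, so the
      truncation in the sign exponent is harmless.\<close>
    proof (cases "m > p")
      case True
      then have "nat (int m - int p) = Suc (nat (int (m - 1) - int p))" "int (m - 1) - int p = int m - int p - 1"
        by auto
      then show ?thesis using True
        by (simp add: elem_sym_insert[OF insert(1,2)] algebra_simps)
    qed (auto simp: elem_sym_insert[OF insert(1,2)])
  qed
  finally show ?case .
qed

text \<open>\<open>R\<close> is an inverse of \<open>G\<close>, and cancelling \<open>G\<close>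
  gives the uniqueness demanded by \<open>THE\<close>.\<close>

lemma mps_quot_unit:
  assumes "G * R = 1" "G * Q = F"
  shows "mps_quot F G = Q"
  unfolding mps_quot_def
proof (rule the_equality)
  fix Q' assume "Q' * G = F"
  then have "Q' * (G * R) = Q * (G * R)" using assms(2) by (simp add: mult_ac flip: mult.assoc)
  then show "Q' = Q" by (simp add: assms(1))
qed (use assms(2) in \<open>simp add: mult.commute\<close>)

section \<open>Parts of a partition and its diagonal boxes\<close>

lemma part_antimono:
  assumes "is_partition la" "1 \<le> i" "i \<le> j"
  shows "part la j \<le> part la i"
  using assms sorted_wrt_nth_less[of "(\<ge>)" la "i - 1" "j - 1"]
  by (cases "i = j") (auto simp: part_def is_partition_def)

lemma part_pos_iff: "is_partition la \<Longrightarrow> part la j > 0 \<longleftrightarrow> 1 \<le> j \<and> j \<le> length la"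
  by (auto simp: part_def is_partition_def) (metis One_nat_def Suc_le_lessD Suc_pred gr0I nth_mem)

text \<open>The diagonal boxes form an initial segment because parts decrease while j grows. Hence j
  <= d decides the sign of the j-th part minus j, the case distinction of
  \<open>dual_coeff\<close>.\<close>

lemma le_num_diag_iff:
  assumes "is_partition la" "1 \<le> j"
  shows "j \<le> num_diag la \<longleftrightarrow> j \<le> part la j"
proof -
  let ?D = "{i. 1 \<le> i \<and> i \<le> part la i}"
  have "{(i, j) \<in> diagram la. i = j} = (\<lambda>i. (i, i)) ` ?D"
    by (auto simp: diagram_def)
  then have nd: "num_diag la = card ?D"
    unfolding num_diag_def by (simp add: card_image inj_on_def)
  have "?D \<subseteq> {1..length la}" by (auto simp: part_def split: if_splits)
  then have fin: "finite ?D" by (rule finite_subset) simp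
  show ?thesis
  proof
    assume "j \<le> part la j"
    then have "{1..j} \<subseteq> ?D" using part_antimono[OF assms(1)] by fastforce
    from card_mono[OF fin this] show "j \<le> num_diag la" by (simp add: nd)
  next
    assume le: "j \<le> num_diag la"
    show "j \<le> part la j"
    proof (rule ccontr)
      assume n: "\<not> j \<le> part la j"
      have "i < j" if "1 \<le> i" "i \<le> part la i" for i
        using n that part_antimono[OF assms, of i] by (cases "j \<le> i") auto
      then have "?D \<subseteq> {1..<j}" by auto
      from card_mono[OF _ this] show False using le assms(2) by (simp add: nd)
    qed
  qed
qed

lemma num_diag_le_length: "is_partition la \<Longrightarrow> num_diag la \<le> length la"
  using le_num_diag_iff[of la "num_diag la"] part_pos_iff[of la "num_diag la"]
  by (cases "num_diag la = 0") auto

abbreviation dual_exp :: "nat list \<Rightarrow> nat \<Rightarrow> int" where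
  "dual_exp la j \<equiv> int (part la j) - int j"

lemma dual_entry_eq:
  assumes "is_partition la" "1 \<le> i" "1 \<le> j" "j \<le> n"
  shows "dual_entry la n i j = divdiff {i - 1} (\<lambda>m. dual_coeff (dual_exp la j) (int m - int n))"
proof -
  obtain i' where i: "i = Suc i'" using assms by (cases i) auto
  define p where "p = part la j + n - j"
  have e: "int m - int n - dual_exp la j = int m - int p" for m
    using assms by (simp add: p_def)
  show ?thesis
  proof (cases "j \<le> part la j")
    case True
    let ?A = "{- dual_exp la j..0}"
    have "dual_entry la n i j = mps_quot (xvar (Suc i') ^ p) (\<Prod>k\<in>?A. 1 - mps_const (avar k) * xvar (Suc i'))"
      using True le_num_diag_iff[OF assms(1,3)] by (simp add: dual_entry_def i p_def)
    also have "\<dots> = divdiff {i'} (\<lambda>m. compl_sym (int m - int p) ?A)"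
      \<comment> \<open>The instance with exponent 0 exhibits the inverse of the
        denominator.\<close>
      by (rule mps_quot_unit[OF _ prod_mult_divdiff_compl_sym])
        (use prod_mult_divdiff_compl_sym[of ?A i' 0] in auto)
    finally show ?thesis using True by (simp add: dual_coeff_def e i)
  next
    case False
    let ?A = "{1..- dual_exp la j - 1}"
    have "dual_entry la n i j = xvar (Suc i') ^ p * (\<Prod>k\<in>?A. 1 - mps_const (avar k) * xvar (Suc i'))"
      using False le_num_diag_iff[OF assms(1,3)] by (simp add: dual_entry_def i p_def)
    also have "\<dots> = divdiff {i'} (\<lambda>m. (-1) ^ nat (int m - int p) * elem_sym (int m - int p) ?A)"
      by (rule xvar_power_mult_prod) simp
    finally show ?thesis using False by (simp add: dual_coeff_def e i)
  qed
qed

text \<open>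
  The divided difference at \<open>x\<^sub>i, \<dots>, x\<^sub>n\<close> of \<open>x\<^sup>n \<Sum>\<^sub>k c\<^sub>k x\<^sup>k\<close>. Thanks to the factor \<open>x\<^sup>n\<close> its coefficients
  do not depend on \<open>n\<close> except through the set of variables.
\<close>

definition laurent_row :: "nat \<Rightarrow> nat \<Rightarrow> (int \<Rightarrow> 'a) \<Rightarrow> 'a::zero mps" where
  "laurent_row n i c =
     Abs_mps (\<lambda>\<alpha>. if Poly_Mapping.keys \<alpha> \<subseteq> {i - 1..<n} then c (int (mdeg \<alpha>) - int i) else 0)"

lemma mcoeff_laurent_row:
  "mcoeff (laurent_row n i c) \<alpha> =
    (if Poly_Mapping.keys \<alpha> \<subseteq> {i - 1..<n} then c (int (mdeg \<alpha>) - int i) else 0)"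
  by (simp add: laurent_row_def)

text \<open>The n - i + 1 nodes raise the exponent by n - i; subtracting n leaves
  \<open>mdeg \<alpha> - i\<close>.\<close>

lemma divdiff_eq_laurent_row:
  "1 \<le> i \<Longrightarrow> i \<le> n \<Longrightarrow> divdiff {i - 1..<n} (\<lambda>m. c (int m - int n)) = laurent_row n i c"
  by (rule mps_eqI) (auto simp: mcoeff_divdiff mcoeff_laurent_row of_nat_diff intro!: arg_cong[where f = c])

definition laurent_det :: "nat \<Rightarrow> (nat \<Rightarrow> int \<Rightarrow> qa) \<Rightarrow> qa mps" where
  "laurent_det n C = det_range 1 n (\<lambda>i j. laurent_row n i (C j))"

lemma mps_quot_eq_laurent_det:
  assumes "\<And>i j. i \<in> {1..n} \<Longrightarrow> j \<in> {1..n} \<Longrightarrow> f i j = divdiff {i - 1} (\<lambda>m. C j (int m - int n))"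
  shows "mps_quot (det_range 1 n f) (vandermonde n) = laurent_det n C"
proof -
  have "mps_quot (det_range 1 n f) (vandermonde n) =
      mps_quot (det_range 1 n (\<lambda>i j. divdiff {i - 1} (\<lambda>m. C j (int m - int n)))) (vandermonde n)"
    by (rule arg_cong[where f = "\<lambda>x. mps_quot x _"], rule det_range_cong, rule assms) auto
  also have "\<dots> = det_range 1 n (\<lambda>i j. divdiff {i - 1..<n} (\<lambda>m. C j (int m - int n)))"
    by (rule mps_quot_alternant)
  also have "\<dots> = laurent_det n C"
    unfolding laurent_det_def by (rule det_range_cong) (rule divdiff_eq_laurent_row)
  finally show ?thesis .
qed

section \<open>Schur and dual Schur polynomials, and their limits in infinitely many
  variables\<close>

definition schur_column :: "nat list \<Rightarrow> nat \<Rightarrow> int \<Rightarrow> qa" where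
  "schur_column la j k = (if k = dual_exp la j then 1 else 0)"

definition dual_column :: "nat list \<Rightarrow> nat \<Rightarrow> int \<Rightarrow> qa" where
  "dual_column la j k = dual_coeff (dual_exp la j) k"

lemma schur_fin_eq: "schur_fin n la = (if length la > n then 0 else laurent_det n (schur_column la))"
proof -
  have "xvar i ^ (part la j + n - j) = divdiff {i - 1} (\<lambda>m. schur_column la j (int m - int n))"
    if "i \<in> {1..n}" "j \<in> {1..n}" for i j
  proof -
    have "xvar (Suc (i - 1)) ^ (part la j + n - j) = divdiff {i - 1} (\<lambda>m. schur_column la j (int m - int n))"
      unfolding xvar_power using that
      by (intro arg_cong[where f = "divdiff {i - 1}"]) (auto simp: schur_column_def fun_eq_iff)
    then show ?thesis using that by simp
  qed
  then have "mps_quot (det_range 1 n (\<lambda>i j. xvar i ^ (part la j + n - j))) (vandermonde n) =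
      laurent_det n (schur_column la)"
    by (rule mps_quot_eq_laurent_det)
  then show ?thesis by (simp only: schur_fin_def)
qed

lemma dual_schur_fin_eq:
  "is_partition la \<Longrightarrow> dual_schur_fin n la = (if length la > n then 0 else laurent_det n (dual_column la))"
proof -
  assume "is_partition la"
  then have "mps_quot (det_range 1 n (dual_entry la n)) (vandermonde n) = laurent_det n (dual_column la)"
    by (intro mps_quot_eq_laurent_det) (simp add: dual_entry_eq dual_column_def)
  then show ?thesis by (simp only: dual_schur_fin_def)
qed

text \<open>At x_{n+1} = 0 no variable is left in the last row, which becomes the constants at
  exponent -(n + 1); the hypothesis leaves only the last of them.\<close>

lemma restrict_vars_laurent_det_Suc:
  assumes "\<And>j. j \<in> {1..n} \<Longrightarrow> C j (- int (Suc n)) = 0"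
  shows "restrict_vars n (laurent_det (Suc n) C) = mps_const (C (Suc n) (- int (Suc n))) * laurent_det n C"
proof -
  have row: "laurent_row n (Suc n) c = mps_const (c (- int (Suc n)))" for c :: "int \<Rightarrow> qa"
    by (rule mps_eqI) (auto simp: mcoeff_laurent_row mps_const_def)
  have "restrict_vars n (laurent_det (Suc n) C) = det_range 1 (Suc n) (\<lambda>i j. restrict_vars n (laurent_row (Suc n) i (C j)))"
    unfolding laurent_det_def by (rule det_range_hom[OF restrict_vars_hom])
  also have "\<dots> = det_range 1 (Suc n) (\<lambda>i j. laurent_row n i (C j))"
  proof (rule det_range_cong, rule mps_eqI)
    fix i j and \<alpha> :: "nat \<Rightarrow>\<^sub>0 nat"
    have "Poly_Mapping.keys \<alpha> \<subseteq> {..<n} \<and> Poly_Mapping.keys \<alpha> \<subseteq> {i - 1..<Suc n} \<longleftrightarrow> Poly_Mapping.keys \<alpha> \<subseteq> {i - 1..<n}"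
      by (auto simp: subset_iff)
    then show "mcoeff (restrict_vars n (laurent_row (Suc n) i (C j))) \<alpha> = mcoeff (laurent_row n i (C j)) \<alpha>"
      by (auto simp: mcoeff_restrict_vars mcoeff_laurent_row)
  qed
  also have "\<dots> = laurent_row n (Suc n) (C (Suc n)) * det_range 1 n (\<lambda>i j. laurent_row n i (C j))"
    by (rule det_range_last_row) (use assms in \<open>simp add: row mps_const_zero\<close>)
  finally show ?thesis by (simp add: row laurent_det_def)
qed

text \<open>A family compatible under restriction has exactly one common lift, so the
  \<open>THE\<close> in \<open>schur\<close> and \<open>dual_schur\<close> is well defined.\<close>

lemma restrict_vars_the_limit:
  assumes "\<And>n. restrict_vars n (S (Suc n)) = S n"
  shows "restrict_vars n (THE F. \<forall>n. restrict_vars n F = S n) = S n"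
proof -
  have le: "restrict_vars m (S n) = S m" if "m \<le> n" for m n
    using that
  proof (induction n rule: dec_induct)
    case base
    show ?case using assms[of m] by (metis restrict_vars_restrict_vars min.idem)
  next
    case (step n)
    then show ?case
      using assms[of n] restrict_vars_restrict_vars[of m n "S (Suc n)"] restrict_vars_restrict_vars[of m "Suc n" "S (Suc n)"]
      by (simp add: min_absorb1)
  qed
  \<comment> \<open>\<open>N \<alpha>\<close> variables suffice to see the monomial
    \<alpha>.\<close>
  define N where "N \<alpha> = Suc (Max (insert 0 (Poly_Mapping.keys \<alpha>)))" for \<alpha> :: "nat \<Rightarrow>\<^sub>0 nat"
  have N: "Poly_Mapping.keys \<alpha> \<subseteq> {..<N \<alpha>}" for \<alpha>
    by (auto simp: N_def less_Suc_eq_le)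
  define F where "F = Abs_mps (\<lambda>\<alpha>. mcoeff (S (N \<alpha>)) \<alpha>)"
  have F: "restrict_vars n F = S n" for n
  proof (rule mps_eqI)
    fix \<alpha>
    have eq: "mcoeff (S m) \<alpha> = mcoeff (S (max n (N \<alpha>))) \<alpha>"
      if "m \<le> max n (N \<alpha>)" "Poly_Mapping.keys \<alpha> \<subseteq> {..<m}" for m
      using arg_cong[OF le[OF that(1)], of "\<lambda>F. mcoeff F \<alpha>"] that(2) by (simp add: mcoeff_restrict_vars)
    have "mcoeff (S n) \<alpha> = 0" if "\<not> Poly_Mapping.keys \<alpha> \<subseteq> {..<n}"
      using arg_cong[OF le[of n n], of "\<lambda>F. mcoeff F \<alpha>"] that by (simp add: mcoeff_restrict_vars)
    then show "mcoeff (restrict_vars n F) \<alpha> = mcoeff (S n) \<alpha>"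
      using eq[of n] eq[of "N \<alpha>"] N by (simp add: mcoeff_restrict_vars F_def)
  qed
  have "(THE F. \<forall>n. restrict_vars n F = S n) = F"
  proof (rule the_equality)
    fix G assume G: "\<forall>n. restrict_vars n G = S n"
    show "G = F"
    proof (rule mps_eqI)
      fix \<alpha>
      have "mcoeff (restrict_vars (N \<alpha>) G) \<alpha> = mcoeff (restrict_vars (N \<alpha>) F) \<alpha>"
        using G F by simp
      then show "mcoeff G \<alpha> = mcoeff F \<alpha>" using N by (simp add: mcoeff_restrict_vars)
    qed
  qed (use F in simp)
  then show ?thesis using F by simp
qed

text \<open>Columns j <= n start at exponents at least -n. Column n + 1 has coefficient 1 at -(n +
  1) if part n + 1 is zero and 0 otherwise, which agrees with the value 0 for partitions with too
  many parts.\<close>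

lemma laurent_det_stable:
  assumes la: "is_partition la"
    and C: "\<And>j k. k < dual_exp la j \<Longrightarrow> C j k = 0" "\<And>j. C j (dual_exp la j) = 1"
  shows "restrict_vars n (if length la > Suc n then 0 else laurent_det (Suc n) C) =
    (if length la > n then 0 else laurent_det n C)"
proof -
  interpret comm_ring_hom "restrict_vars n" by (rule restrict_vars_hom)
  have "restrict_vars n (laurent_det (Suc n) C) = mps_const (C (Suc n) (- int (Suc n))) * laurent_det n C"
    by (rule restrict_vars_laurent_det_Suc) (auto intro: C)
  moreover have "C (Suc n) (- int (Suc n)) = (if length la > n then 0 else 1)"
    using C(1)[of "- int (Suc n)" "Suc n"] C(2)[of "Suc n"] part_pos_iff[OF la, of "Suc n"]
    by (cases "length la > n") auto
  ultimately show ?thesis by (auto simp: mps_const_zero mps_const_one)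
qed

lemma mcoeff_schur:
  assumes "is_partition la" "Poly_Mapping.keys \<alpha> \<subseteq> {..<n}" "length la \<le> n"
  shows "mcoeff (schur la) \<alpha> = mcoeff (laurent_det n (schur_column la)) \<alpha>"
proof -
  have "restrict_vars n (schur la) = schur_fin n la"
    unfolding schur_def
    by (rule restrict_vars_the_limit, unfold schur_fin_eq, rule laurent_det_stable)
      (use assms(1) in \<open>auto simp: schur_column_def\<close>)
  from arg_cong[OF this, of "\<lambda>F. mcoeff F \<alpha>"] show ?thesis
    using assms(2,3) by (simp add: mcoeff_restrict_vars schur_fin_eq)
qed

lemma mcoeff_dual_schur:
  assumes "is_partition la" "Poly_Mapping.keys \<alpha> \<subseteq> {..<n}"
  shows "mcoeff (dual_schur la) \<alpha> = (if length la > n then 0 else mcoeff (laurent_det n (dual_column la)) \<alpha>)"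
proof -
  have "restrict_vars n (dual_schur la) = dual_schur_fin n la"
    unfolding dual_schur_def
    by (rule restrict_vars_the_limit, unfold dual_schur_fin_eq[OF assms(1)], rule laurent_det_stable)
      (use assms(1) in \<open>auto simp: dual_column_def dual_coeff_lt dual_coeff_same\<close>)
  from arg_cong[OF this, of "\<lambda>F. mcoeff F \<alpha>"] show ?thesis
    using assms(2) by (simp add: mcoeff_restrict_vars dual_schur_fin_eq[OF assms(1)])
qed

section \<open>The Cauchy--Binet formula\<close>

text \<open>The family \<open>en\<close> lists each n-element subset of \<open>S\<close> once, in
  any order, since reordering changes both minors by the same sign. Expanding all entries gives a
  sum over maps from the row indices to \<open>S\<close>.\<close>

lemma cauchy_binet_mat:
  fixes A :: "nat \<Rightarrow> 's \<Rightarrow> 'a :: comm_ring_1" and B :: "'s \<Rightarrow> nat \<Rightarrow> 'a" and en :: "'l \<Rightarrow> nat \<Rightarrow> 's"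
  assumes fin: "finite S"
    and bij: "bij_betw (\<lambda>l. en l ` {0..<n}) L {T. T \<subseteq> S \<and> card T = n}"
  shows "det (mat n n (\<lambda>(i, j). \<Sum>s\<in>S. A i s * B s j)) =
    (\<Sum>l\<in>L. det (mat n n (\<lambda>(i, k). A i (en l k))) * det (mat n n (\<lambda>(k, j). B (en l k) j)))"
proof -
  let ?U = "{0..<n}"
  let ?P = "{p. p permutes ?U}"
  let ?g = "\<lambda>\<phi>. (\<Prod>i\<in>?U. A i (\<phi> i)) * det (mat n n (\<lambda>(i, j). B (\<phi> i) j))"
  let ?inj = "{\<phi> \<in> ?U \<rightarrow>\<^sub>E S. inj_on \<phi> ?U}"
  let ?F = "\<lambda>(l, q). restrict (en l \<circ> q) ?U"
  have finP: "finite ?P" by (rule finite_permutations) simp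
  have finE: "finite (?U \<rightarrow>\<^sub>E S)" using fin by (intro finite_PiE) auto
  have "det (mat n n (\<lambda>(i, j). \<Sum>s\<in>S. A i s * B s j)) =
      (\<Sum>p\<in>?P. signof p * (\<Prod>i\<in>?U. \<Sum>s\<in>S. A i s * B s (p i)))"
    by (subst det_def'[of _ n]) (auto intro!: sum.cong prod.cong simp: permutes_in_image)
  also have "\<dots> = (\<Sum>p\<in>?P. \<Sum>\<phi>\<in>?U \<rightarrow>\<^sub>E S. signof p * ((\<Prod>i\<in>?U. A i (\<phi> i)) * (\<Prod>i\<in>?U. B (\<phi> i) (p i))))"
    using fin by (subst prod_sum_PiE) (auto simp: sum_distrib_left prod.distrib)
  also have "\<dots> = (\<Sum>\<phi>\<in>?U \<rightarrow>\<^sub>E S. \<Sum>p\<in>?P. signof p * ((\<Prod>i\<in>?U. A i (\<phi> i)) * (\<Prod>i\<in>?U. B (\<phi> i) (p i))))"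
    by (rule sum.swap)
  also have "\<dots> = (\<Sum>\<phi>\<in>?U \<rightarrow>\<^sub>E S. ?g \<phi>)"
  proof (rule sum.cong[OF refl])
    fix \<phi>
    have "det (mat n n (\<lambda>(i, j). B (\<phi> i) j)) = (\<Sum>p\<in>?P. signof p * (\<Prod>i\<in>?U. B (\<phi> i) (p i)))"
      by (subst det_def'[of _ n]) (auto intro!: sum.cong prod.cong simp: permutes_in_image)
    then show "(\<Sum>p\<in>?P. signof p * ((\<Prod>i\<in>?U. A i (\<phi> i)) * (\<Prod>i\<in>?U. B (\<phi> i) (p i)))) = ?g \<phi>"
      by (simp add: sum_distrib_left mult.left_commute)
  qed
  \<comment> \<open>A map that is not injective repeats a row of the \<open>B\<close>
    matrix.\<close>
  also have "\<dots> = (\<Sum>\<phi>\<in>?inj. ?g \<phi>)"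
  proof (rule sum.mono_neutral_right[OF finE])
    show "\<forall>\<phi>\<in>(?U \<rightarrow>\<^sub>E S) - ?inj. ?g \<phi> = 0"
    proof
      fix \<phi> assume "\<phi> \<in> (?U \<rightarrow>\<^sub>E S) - ?inj"
      then obtain i j where ij: "i < n" "j < n" "i \<noteq> j" "\<phi> i = \<phi> j"
        by (auto simp: inj_on_def)
      have "det (mat n n (\<lambda>(i, j). B (\<phi> i) j)) = 0"
        by (rule det_identical_rows[OF _ ij(3,1,2)]) (use ij in \<open>auto intro!: eq_vecI\<close>)
      then show "?g \<phi> = 0" by simp
    qed
  qed auto
  \<comment> \<open>An injective map is uniquely \<open>en l\<close> after a permutation, with
    \<open>l\<close> determined by the image.\<close>
  also have "\<dots> = (\<Sum>x\<in>L \<times> ?P. ?g (?F x))"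
  proof -
    have en: "en l ` ?U \<subseteq> S" "inj_on (en l) ?U" if "l \<in> L" for l
    proof -
      have "en l ` ?U \<in> {T. T \<subseteq> S \<and> card T = n}" 
        using bij_betw_apply[OF bij that] .
      then show "en l ` ?U \<subseteq> S" "inj_on (en l) ?U" by (auto intro: eq_card_imp_inj_on)
    qed
    have img: "?F (l, q) ` ?U = en l ` ?U" if "q permutes ?U" for l q
    proof -
      have "?F (l, q) ` ?U = en l ` (q ` ?U)"
        unfolding image_image by (rule image_cong) auto
      then show ?thesis by (simp only: permutes_image[OF that])
    qed
    have "inj_on ?F (L \<times> ?P)"
    proof (rule inj_onI)
      fix x x' assume "x \<in> L \<times> ?P" "x' \<in> L \<times> ?P" and Feq: "?F x = ?F x'"
      then obtain l q l' q' where lq: "l \<in> L" "q permutes ?U" "l' \<in> L" "q' permutes ?U"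
        and x: "x = (l, q)" "x' = (l', q')" by auto
      have eq: "?F (l, q) = ?F (l', q')" using Feq unfolding x .
      have "en l ` ?U = en l' ` ?U" using img[OF lq(2)] img[OF lq(4)] eq by metis
      then have l: "l = l'" using bij lq by (auto simp: bij_betw_def inj_on_def)
      have "q i = q' i" for i
      proof (cases "i \<in> ?U")
        case True
        then have "en l (q i) = en l (q' i)"
          using fun_cong[OF eq, of i] l by simp
        moreover have "q i \<in> ?U" "q' i \<in> ?U"
          using True permutes_in_image[OF lq(2)] permutes_in_image[OF lq(4)] by auto
        ultimately show ?thesis
          using inj_onD[OF en(2)[OF lq(1)]] by blast
      next
        case False
        then show ?thesis using lq by (simp add: permutes_not_in)
      qed
      then show "x = x'" using l x by auto
    qed
    moreover have "?F ` (L \<times> ?P) = ?inj"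
    proof (intro equalityI subsetI)
      fix \<phi> assume "\<phi> \<in> ?F ` (L \<times> ?P)"
      then obtain l q where lq: "l \<in> L" "q permutes ?U" and phi: "\<phi> = ?F (l, q)" by auto
      have "inj_on (en l \<circ> q) ?U"
        using lq en(2)[OF lq(1)] by (intro comp_inj_on) (auto simp: permutes_image permutes_inj_on)
      moreover have "\<phi> ` ?U \<subseteq> S" unfolding phi img[OF lq(2)] by (rule en(1)[OF lq(1)])
      ultimately show "\<phi> \<in> ?inj" by (auto simp: phi inj_on_def)
    next
      fix \<phi> assume phi: "\<phi> \<in> ?inj"
      then have "\<phi> ` ?U \<in> {T. T \<subseteq> S \<and> card T = n}" by (auto simp: card_image)
      then have "\<phi> ` ?U \<in> (\<lambda>l. en l ` ?U) ` L" using bij by (simp only: bij_betw_def)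
      then obtain l where l: "l \<in> L" "en l ` ?U = \<phi> ` ?U" by blast
      define q where "q i = (if i \<in> ?U then inv_into ?U (en l) (\<phi> i) else i)" for i
      have enq: "en l (q i) = \<phi> i" "q i \<in> ?U" if "i \<in> ?U" for i
      proof -
        have "\<phi> i \<in> en l ` ?U" using that l(2) by auto
        then show "en l (q i) = \<phi> i" "q i \<in> ?U"
          using that f_inv_into_f[of "\<phi> i" "en l" ?U] inv_into_into[of "\<phi> i" "en l" ?U]
          by (simp_all add: q_def)
      qed
      have "inj_on q ?U"
      proof (rule inj_onI)
        fix i j assume ij: "i \<in> ?U" "j \<in> ?U" "q i = q j"
        then have "\<phi> i = \<phi> j" using enq(1)[of i] enq(1)[of j] by simp
        then show "i = j" using phi ij by (auto dest: inj_onD)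
      qed
      moreover have "q ` ?U \<subseteq> ?U" using enq(2) by blast
      ultimately have "bij_betw q ?U ?U"
        by (simp add: bij_betw_def endo_inj_surj)
      then have "q permutes ?U" by (rule bij_imp_permutes) (simp add: q_def)
      moreover have "\<phi> = ?F (l, q)"
      proof
        fix i show "\<phi> i = ?F (l, q) i"
          using phi enq(1)[of i] by (cases "i \<in> ?U") (auto simp: PiE_def extensional_def)
      qed
      ultimately show "\<phi> \<in> ?F ` (L \<times> ?P)"
        using l(1) by (intro image_eqI[of _ _ "(l, q)"]) auto
    qed
    ultimately show ?thesis using sum.reindex[of ?F "L \<times> ?P" ?g] by (simp only: comp_def)
  qed
  also have "\<dots> = (\<Sum>l\<in>L. \<Sum>q\<in>?P. ?g (?F (l, q)))"
    by (simp add: sum.cartesian_product case_prod_beta)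
  also have "\<dots> = (\<Sum>l\<in>L. det (mat n n (\<lambda>(i, k). A i (en l k))) * det (mat n n (\<lambda>(k, j). B (en l k) j)))"
  proof (rule sum.cong[OF refl])
    fix l
    let ?B = "mat n n (\<lambda>(k, j). B (en l k) j)"
    have "?g (?F (l, q)) = signof q * (\<Prod>i\<in>?U. A i (en l (q i))) * det ?B" if "q permutes ?U" for q
    proof -
      \<comment> \<open>Sorting the rows of \<open>B\<close> yields the sign of \<open>q\<close>,
        which completes the Leibniz sum of the minor of \<open>A\<close>.\<close>
      have "det (mat n n (\<lambda>(i, j). B (?F (l, q) i) j)) = det (mat n n (\<lambda>(i, j). ?B $$ (q i, j)))"
        using permutes_in_image[OF that] by (intro arg_cong[where f = det] eq_matI) auto
      also have "\<dots> = signof q * det ?B"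
        by (rule det_permute_rows[OF _ that]) simp
      finally show ?thesis by (simp add: mult_ac)
    qed
    then have "(\<Sum>q\<in>?P. ?g (?F (l, q))) = (\<Sum>q\<in>?P. signof q * (\<Prod>i\<in>?U. A i (en l (q i)))) * det ?B"
      by (simp add: sum_distrib_right)
    also have "(\<Sum>q\<in>?P. signof q * (\<Prod>i\<in>?U. A i (en l (q i)))) = det (mat n n (\<lambda>(i, k). A i (en l k)))"
      by (subst det_def'[of _ n]) (auto intro!: sum.cong prod.cong simp: permutes_in_image)
    finally show "(\<Sum>q\<in>?P. ?g (?F (l, q))) = det (mat n n (\<lambda>(i, k). A i (en l k))) * det ?B" .
  qed
  finally show ?thesis .
qed

lemma cauchy_binet:
  fixes A :: "nat \<Rightarrow> 's \<Rightarrow> 'a :: comm_ring_1" and B :: "'s \<Rightarrow> nat \<Rightarrow> 'a" and en :: "'l \<Rightarrow> nat \<Rightarrow> 's"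
  assumes "finite S" "bij_betw (\<lambda>l. en l ` {1..n}) L {T. T \<subseteq> S \<and> card T = n}"
  shows "det_range 1 n (\<lambda>i j. \<Sum>s\<in>S. A i s * B s j) =
    (\<Sum>l\<in>L. det_range 1 n (\<lambda>i k. A i (en l k)) * det_range 1 n (\<lambda>k j. B (en l k) j))"
proof -
  have "(\<lambda>i. en l (1 + i)) ` {0..<n} = en l ` {1..n}" for l
    using image_image[of "en l" Suc "{0..<n}"] by (simp add: atLeastLessThanSuc_atLeastAtMost)
  then show ?thesis
    using cauchy_binet_mat[OF assms(1), of "\<lambda>l i. en l (1 + i)" n L "\<lambda>i. A (1 + i)" "\<lambda>s j. B s (1 + j)"] assms(2)
    by (simp add: det_range_def)
qed

section \<open>Partitions and sets of integers\<close>

lemma partition_eqI: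
  assumes "is_partition la" "is_partition mu" and eq: "\<And>j. 1 \<le> j \<Longrightarrow> part la j = part mu j"
  shows "la = mu"
proof (rule nth_equalityI)
  have "1 \<le> j \<Longrightarrow> j \<le> length la \<longleftrightarrow> j \<le> length mu" for j
    using part_pos_iff[OF assms(1), of j] part_pos_iff[OF assms(2), of j] eq[of j] by simp
  from this[of "length la"] this[of "length mu"] show len: "length la = length mu"
    by (cases "length la = 0"; cases "length mu = 0") auto
  fix i assume "i < length la"
  then show "la ! i = mu ! i" using eq[of "Suc i"] len by (simp add: part_def)
qed

lemma partition_exists:
  fixes f :: "nat \<Rightarrow> nat"
  assumes anti: "\<And>i j. 1 \<le> i \<Longrightarrow> i \<le> j \<Longrightarrow> f j \<le> f i" and z: "\<And>j. j > n \<Longrightarrow> f j = 0"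
  obtains la where "is_partition la" "length la \<le> n" "\<And>j. 1 \<le> j \<Longrightarrow> part la j = f j"
proof
  \<comment> \<open>The list is cut before the first zero value, at \<open>N + 1\<close>;
    monotonicity makes all later values zero.\<close>
  define N where "N = (LEAST N. f (Suc N) = 0)"
  have N: "f (Suc N) = 0" unfolding N_def by (rule LeastI[of _ n]) (simp add: z)
  have le: "N \<le> n" unfolding N_def by (rule Least_le) (simp add: z)
  have pos: "f j > 0" if "1 \<le> j" "j \<le> N" for j
    using not_less_Least[of "j - 1" "\<lambda>N. f (Suc N) = 0"] that by (simp add: N_def)
  define la where "la = map f [1..<Suc N]"
  have "0 \<notin> set la"
  proof
    assume "0 \<in> set la"
    then obtain j where "j \<in> {1..<Suc N}" "f j = 0" by (auto simp: la_def simp del: upt_Suc)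
    then show False using pos[of j] by simp
  qed
  moreover have "sorted_wrt (\<ge>) la"
    unfolding la_def sorted_wrt_map
    by (rule sorted_wrt_mono_rel[OF _ sorted_wrt_upt]) (auto intro: anti simp del: upt_Suc)
  ultimately show "is_partition la" by (simp add: is_partition_def)
  show "length la \<le> n" using le by (simp add: la_def)
  fix j :: nat assume "1 \<le> j"
  then show "part la j = f j"
    using anti[of "Suc N" j] N by (auto simp: part_def la_def not_le simp del: upt_Suc)
qed

lemma dual_exp_strict_antimono:
  "is_partition la \<Longrightarrow> 1 \<le> i \<Longrightarrow> i < j \<Longrightarrow> dual_exp la j < dual_exp la i"
  using part_antimono[of la i j] by simp

lemma dual_exp_antimono:
  "is_partition la \<Longrightarrow> 1 \<le> i \<Longrightarrow> i \<le> j \<Longrightarrow> dual_exp la j \<le> dual_exp la i"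
  using part_antimono[of la i j] by simp

lemma strict_sorted_nth_diff:
  fixes xs :: "int list"
  assumes "sorted xs" "distinct xs" "i \<le> k" "k < length xs"
  shows "int k - int i \<le> xs ! k - xs ! i"
  using assms(3,4)
proof (induction k rule: dec_induct)
  case (step k)
  have "xs ! k \<le> xs ! Suc k" "xs ! k \<noteq> xs ! Suc k"
    using assms(1,2) step by (auto simp: sorted_nth_mono nth_eq_iff_index_eq)
  then show ?case using step by simp
qed simp

text \<open>A partition is encoded by its strictly decreasing exponents. At most n parts means that
  the n-th is at least -n, and the bound on part 1 means that the first is below K.\<close>

lemma bij_betw_partitions_subsets:
  "bij_betw (\<lambda>la. dual_exp la ` {1..n}) {la. is_partition la \<and> length la \<le> n \<and> part la 1 \<le> K}
    {T. T \<subseteq> {- int n..<int K} \<and> card T = n}"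
  (is "bij_betw ?F ?L ?T")
  unfolding bij_betw_def
proof
  \<comment> \<open>Negation turns the decreasing exponents into an increasing list, which is
    determined by its set.\<close>
  have xs: "sorted (map (\<lambda>j. - dual_exp la j) [1..<Suc n])" "distinct (map (\<lambda>j. - dual_exp la j) [1..<Suc n])"
    "set (map (\<lambda>j. - dual_exp la j) [1..<Suc n]) = uminus ` ?F la" if "is_partition la" for la
  proof -
    let ?f = "\<lambda>j. - dual_exp la j"
    have mono: "?f i \<le> ?f j" if "1 \<le> i" "i < j" for i j
      using dual_exp_antimono[OF \<open>is_partition la\<close>, of i j] that by simp
    show "sorted (map ?f [1..<Suc n])"
      unfolding sorted_map
      by (rule sorted_wrt_mono_rel[OF _ sorted_wrt_upt], rule mono) (auto simp del: upt_Suc)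
    have "inj_on ?f {1..<Suc n}"
      by (rule inj_onI) (metis atLeastLessThan_iff dual_exp_strict_antimono less_irrefl linorder_neqE_nat neg_equal_iff_equal that)
    then show "distinct (map ?f [1..<Suc n])" by (simp add: distinct_map del: upt_Suc)
    show "set (map ?f [1..<Suc n]) = uminus ` ?F la"
      by (simp add: image_image atLeastLessThanSuc_atLeastAtMost del: upt_Suc)
  qed
  show "inj_on ?F ?L"
  proof (rule inj_onI, clarify)
    fix la mu assume la: "is_partition la" "length la \<le> n" and mu: "is_partition mu" "length mu \<le> n"
      and eq: "?F la = ?F mu"
    have "map (\<lambda>j. - dual_exp la j) [1..<Suc n] = map (\<lambda>j. - dual_exp mu j) [1..<Suc n]"
      by (rule sorted_distinct_set_unique) (use xs[OF la(1)] xs[OF mu(1)] eq in \<open>simp_all del: upt_Suc\<close>)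
    then have "part la j = part mu j" if "1 \<le> j" "j \<le> n" for j
      using that by (auto simp del: upt_Suc)
    moreover have "part la j = part mu j" if "n < j" for j
      using that la mu by (simp add: part_def)
    ultimately have "part la j = part mu j" if "1 \<le> j" for j
      using that by (cases "j \<le> n") auto
    then show "la = mu" using la mu by (intro partition_eqI) auto
  qed
  show "?F ` ?L = ?T"
  proof (intro equalityI subsetI)
    fix T assume "T \<in> ?F ` ?L"
    then obtain la where la: "is_partition la" "part la 1 \<le> K" "T = ?F la" by auto
    have "card (uminus ` ?F la) = n"
      using distinct_card[OF xs(2)[OF la(1)]] xs(3)[OF la(1)] by (simp del: upt_Suc)
    then have "card T = n" by (simp add: card_image la(3))
    moreover have "dual_exp la j \<in> {- int n..<int K}" if "j \<in> {1..n}" for j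
      using dual_exp_antimono[OF la(1), of 1 j] la(2) that by auto
    ultimately show "T \<in> ?T" using la(3) by auto
  next
    fix T assume T: "T \<in> ?T"
    then have finT: "finite T" by (auto intro: finite_subset)
    define xs where "xs = sorted_list_of_set (uminus ` T)"
    have len: "length xs = n" using T by (simp add: xs_def card_image)
    have set: "set xs = uminus ` T" using finT by (simp add: xs_def)
    have step: "int k - int i \<le> xs ! k - xs ! i" if "i \<le> k" "k < n" for i k
      by (rule strict_sorted_nth_diff) (use that len in \<open>auto simp: xs_def\<close>)
    have bd: "xs ! i \<le> int n" "xs ! i > - int K" if "i < n" for i
    proof -
      have "xs ! i \<in> uminus ` T" using that len set nth_mem by metis
      then show "xs ! i \<le> int n" "xs ! i > - int K" using T by auto
    qed
    \<comment> \<open>Entries grow by at least 1 up to the last, which is at most n. This makes the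
      parts defined next nonnegative.\<close>
    have nonneg: "xs ! i \<le> int i + 1" if "i < n" for i
      using step[of i "n - 1"] bd(1)[of "n - 1"] that by linarith
    define f where "f j = (if j \<le> n then nat (int j - xs ! (j - 1)) else 0)" for j
    have "f j \<le> f i" if "1 \<le> i" "i \<le> j" for i j
    proof (cases "j \<le> n")
      case True
      then have "i - 1 \<le> j - 1" "j - 1 < n" "int (j - 1) - int (i - 1) = int j - int i" using that by auto
      with step[of "i - 1" "j - 1"] True that show ?thesis by (simp add: f_def nat_mono)
    qed (simp add: f_def)
    moreover have "f j = 0" if "j > n" for j using that by (simp add: f_def)
    ultimately obtain la where la: "is_partition la" "length la \<le> n" "\<And>j. 1 \<le> j \<Longrightarrow> part la j = f j"
      using partition_exists by blast
    have "part la 1 \<le> K"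
      using bd(2)[of 0] by (auto simp: la f_def)
    moreover have "?F la = T"
    proof -
      have "?F la = (\<lambda>j. - (xs ! (j - 1))) ` {1..n}"
      proof (rule image_cong[OF refl])
        fix j assume j: "j \<in> {1..n}"
        then show "dual_exp la j = - (xs ! (j - 1))"
          using nonneg[of "j - 1"] la(3)[of j] by (auto simp: f_def of_nat_diff)
      qed
      also have "\<dots> = uminus ` (\<lambda>i. xs ! i) ` {0..<n}"
      proof -
        have "{1..n} = Suc ` {0..<n}" by (simp add: atLeastLessThanSuc_atLeastAtMost)
        then show ?thesis by (simp only: image_image diff_Suc_1)
      qed
      also have "(\<lambda>i. xs ! i) ` {0..<n} = set xs" unfolding len[symmetric] using nth_image[of "length xs" xs] by simp
      also have "uminus ` set xs = T" unfolding set image_image by simp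
      finally show ?thesis .
    qed
    ultimately show "T \<in> ?F ` ?L"
      using la(1,2) by (intro image_eqI[of _ _ la] CollectI conjI) (simp_all only:)
  qed
qed

section \<open>The expansion of Schur functions\<close>

lemma diagram_subset_iff: "diagram mu \<subseteq> diagram la \<longleftrightarrow> (\<forall>i. part mu i \<le> part la i)"
proof
  assume sub: "diagram mu \<subseteq> diagram la"
  show "\<forall>i. part mu i \<le> part la i"
  proof
    fix i
    show "part mu i \<le> part la i"
    proof (cases "part mu i = 0")
      case False
      then have "(i, part mu i) \<in> diagram mu" by (auto simp: diagram_def part_def split: if_splits)
      then show ?thesis using sub by (auto simp: diagram_def)
    qed simp
  qed
qed (auto simp: diagram_def intro: order_trans)

text \<open>The left side has the form produced by \<open>det_range_scale\<close>. In row i the two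
  exponents, nonnegative by the diagonal condition, add up to the number of skew boxes plus an even
  number.\<close>

lemma minus_one_power_skew_card:
  fixes la mu :: "nat list"
  assumes sub: "diagram mu \<subseteq> diagram la" and diag: "\<And>i. 1 \<le> i \<Longrightarrow> i \<le> d \<Longrightarrow> i \<le> part mu i"
  shows "(\<Prod>i = 1..d. (-1) ^ nat (dual_exp la i)) * (\<Prod>i = 1..d. (-1) ^ nat (dual_exp mu i)) =
    (-1 :: 'a :: comm_ring_1) ^ card {(i, j) \<in> diagram la - diagram mu. i \<le> d}"
proof -
  have le: "part mu i \<le> part la i" for i using sub by (simp add: diagram_subset_iff)
  have "{(i, j) \<in> diagram la - diagram mu. i \<le> d} = (SIGMA i:{1..d}. {part mu i<..part la i})"
    by (auto simp: diagram_def not_le)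
  then have card: "card {(i, j) \<in> diagram la - diagram mu. i \<le> d} = (\<Sum>i = 1..d. part la i - part mu i)"
    by simp
  have "(-1 :: 'a) ^ nat (dual_exp la i) * (-1) ^ nat (dual_exp mu i) = (-1) ^ (part la i - part mu i)"
    if "i \<in> {1..d}" for i
  proof -
    have e: "nat (dual_exp la i) + nat (dual_exp mu i) = (part la i - part mu i) + 2 * nat (dual_exp mu i)"
      using that diag[of i] le[of i] by auto
    show ?thesis unfolding power_add[symmetric] e by (simp add: power_add power_mult)
  qed
  then show ?thesis
    unfolding card power_sum prod.distrib[symmetric] by (rule prod.cong[OF refl])
qed

lemma det_range_unit_upper_triangular:
  assumes "\<And>i j. l \<le> i \<Longrightarrow> i \<le> u \<Longrightarrow> l \<le> j \<Longrightarrow> j \<le> u \<Longrightarrow> j \<le> i \<Longrightarrow> f i j = (if i = j then 1 else 0)"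
  shows "det_range l u f = 1"
proof -
  have "det_range l u f = prod_list (diag_mat (mat (u + 1 - l) (u + 1 - l) (\<lambda>(i, j). f (l + i) (l + j))))"
    unfolding det_range_def
    by (rule det_upper_triangular[of _ "u + 1 - l"]) (auto simp: upper_triangular_def assms)
  also have "\<dots> = 1"
    unfolding prod_list_diag_prod by (rule prod.neutral) (auto simp: assms)
  finally show ?thesis .
qed

text \<open>Each failure creates an oversized zero block: for different diagonals negative exponents
  of one partition meet nonnegative ones of the other, and if row k of \<open>mu\<close> is longer
  than that of \<open>la\<close>, all rows from k on have t < m in columns up to k.\<close>

lemma det_dual_coeff_inv_eq_0:
  assumes la: "is_partition la" "length la \<le> n" and mu: "is_partition mu" "length mu \<le> n"
    and "num_diag la \<noteq> num_diag mu \<or> \<not> diagram mu \<subseteq> diagram la"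
  shows "det_range 1 n (\<lambda>i j. dual_coeff_inv (dual_exp la i) (dual_exp mu j)) = 0"
proof -
  consider "num_diag la < num_diag mu" | "num_diag mu < num_diag la" | "\<not> diagram mu \<subseteq> diagram la"
    using assms by linarith
  then show ?thesis
  proof cases
    case 1
    let ?k = "num_diag la + 1"
    have "dual_coeff_inv (dual_exp la i) (dual_exp mu j) = 0" if "?k \<le> i" "1 \<le> j" "j \<le> ?k" for i j
      using that 1 le_num_diag_iff[OF la(1), of i] le_num_diag_iff[OF mu(1), of j]
      by (simp add: dual_coeff_inv_def)
    then show ?thesis
      using 1 num_diag_le_length[OF mu(1)] mu(2) by (intro det_range_zero_block[of _ ?k]) auto
  next
    case 2
    let ?k = "num_diag mu + 1"
    have "dual_coeff_inv (dual_exp la i) (dual_exp mu j) = 0" if "?k \<le> j" "1 \<le> i" "i \<le> ?k" for i j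
      using that 2 le_num_diag_iff[OF la(1), of i] le_num_diag_iff[OF mu(1), of j]
      by (simp add: dual_coeff_inv_def)
    then have "det_range 1 n (\<lambda>j i. dual_coeff_inv (dual_exp la i) (dual_exp mu j)) = 0"
      using 2 num_diag_le_length[OF la(1)] la(2) by (intro det_range_zero_block[of _ ?k]) auto
    then show ?thesis by (rule trans[OF det_range_transpose[symmetric]])
  next
    case 3
    then obtain k where k: "part la k < part mu k" by (auto simp: diagram_subset_iff not_le)
    then have k': "1 \<le> k" "k \<le> n" using part_pos_iff[OF mu(1), of k] mu(2) by auto
    have "dual_coeff_inv (dual_exp la i) (dual_exp mu j) = 0" if "k \<le> i" "1 \<le> j" "j \<le> k" for i j
      using dual_exp_antimono[OF la(1) k'(1) that(1)] dual_exp_antimono[OF mu(1) that(2,3)] k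
      by (intro dual_coeff_inv_lt) linarith
    then show ?thesis using k' by (intro det_range_zero_block[of _ k]) auto
  qed
qed

text \<open>The matrix splits at d because rows beyond d have negative exponents and columns up to d
  nonnegative ones; the signs then separate into row and column factors.\<close>

lemma det_dual_coeff_inv_eq:
  assumes la: "is_partition la" "length la \<le> n" and mu: "is_partition mu"
    and d: "num_diag la = d" "num_diag mu = d" and sub: "diagram mu \<subseteq> diagram la"
  shows "det_range 1 n (\<lambda>i j. dual_coeff_inv (dual_exp la i) (dual_exp mu j)) =
    (-1) ^ card {(i, j) \<in> diagram la - diagram mu. i \<le> d} *
    det_range 1 d
      (\<lambda>i j. elem_sym (int (part la i) - int (part mu j) - int i + int j) {int i - int (part la i) + 1..0}) *
    det_range (d + 1) (length la)
      (\<lambda>i j. compl_sym (int (part la i) - int (part mu j) - int i + int j) {1..int i - int (part la i)})"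
proof -
  let ?W = "\<lambda>i j. dual_coeff_inv (dual_exp la i) (dual_exp mu j)"
  let ?e = "\<lambda>i j. elem_sym (int (part la i) - int (part mu j) - int i + int j) {int i - int (part la i) + 1..0}"
  let ?h = "\<lambda>i j. compl_sym (int (part la i) - int (part mu j) - int i + int j) {1..int i - int (part la i)}"
  have dl: "d \<le> length la" using num_diag_le_length[OF la(1)] d by simp
  have diag: "i \<le> d \<longleftrightarrow> i \<le> part la i" "i \<le> d \<longleftrightarrow> i \<le> part mu i" if "1 \<le> i" for i
    using le_num_diag_iff[OF la(1) that] le_num_diag_iff[OF mu that] d by auto
  have mu0: "part mu i = 0" "part la i = 0" if "i > length la" for i
  proof -
    show "part la i = 0" using that by (simp add: part_def)
    moreover have "part mu i \<le> part la i" using sub by (simp add: diagram_subset_iff)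
    ultimately show "part mu i = 0" by simp
  qed
  have idx: "dual_exp la i - dual_exp mu j = int (part la i) - int (part mu j) - int i + int j" for i j
    by simp
  have "det_range 1 n ?W = det_range 1 d ?W * det_range (d + 1) n ?W"
  proof (rule det_range_block)
    fix i j assume "d < i" "i \<le> n" "1 \<le> j" "j \<le> d"
    then show "?W i j = 0" using diag(1)[of i] diag(2)[of j] by (simp add: dual_coeff_inv_def)
  qed (use dl la in auto)
  also have "det_range 1 d ?W = det_range 1 d
      (\<lambda>i j. (-1) ^ nat (dual_exp la i) * (-1) ^ nat (dual_exp mu j) * ?e i j)"
  proof (rule det_range_cong)
    fix i j assume ij: "1 \<le> i" "i \<le> d" "1 \<le> j" "j \<le> d"
    then have nn: "0 \<le> dual_exp la i" "0 \<le> dual_exp mu j" using diag(1)[of i] diag(2)[of j] by auto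
    have "?W i j = (-1) ^ nat (int (nat (dual_exp la i)) - int (nat (dual_exp mu j))) *
        elem_sym (int (nat (dual_exp la i)) - int (nat (dual_exp mu j))) {int i - int (part la i) + 1..0}"
      using nn by (simp add: dual_coeff_inv_def)
    also have "\<dots> = (-1) ^ (nat (dual_exp la i) + nat (dual_exp mu j)) *
        elem_sym (int (nat (dual_exp la i)) - int (nat (dual_exp mu j))) {int i - int (part la i) + 1..0}"
      by (rule sign_elem_sym[symmetric])
    also have "int (nat (dual_exp la i)) - int (nat (dual_exp mu j)) = int (part la i) - int (part mu j) - int i + int j"
      using nn by simp
    finally show "?W i j = (-1) ^ nat (dual_exp la i) * (-1) ^ nat (dual_exp mu j) * ?e i j"
      by (simp only: power_add)
  qed
  also have "\<dots> = (-1) ^ card {(i, j) \<in> diagram la - diagram mu. i \<le> d} * det_range 1 d ?e"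
    unfolding det_range_scale by (subst minus_one_power_skew_card[OF sub]) (use diag(2) in auto)
  also have "det_range (d + 1) n ?W = det_range (d + 1) n ?h"
  proof (rule det_range_cong)
    fix i j assume "d + 1 \<le> i" "i \<le> n" "d + 1 \<le> j" "j \<le> n"
    then have "dual_exp la i < 0" "dual_exp mu j < 0" using diag(1)[of i] diag(2)[of j] by auto
    then show "?W i j = ?h i j" unfolding dual_coeff_inv_def idx by simp
  qed
  \<comment> \<open>Beyond \<open>length la\<close> both partitions have zero parts, so the trailing
    block is unit upper triangular.\<close>
  also have "\<dots> = det_range (d + 1) (length la) ?h * det_range (length la + 1) n ?h"
    by (rule det_range_block) (use dl la(2) mu0 in auto)
  also have "det_range (length la + 1) n ?h = 1"
    by (rule det_range_unit_upper_triangular) (use mu0 in \<open>auto simp: compl_sym_0\<close>)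
  finally show ?thesis by (simp add: mult.assoc)
qed

text \<open>In degrees up to \<open>D\<close>, row i >= 1 involves only exponents below D, and j <=
  n bounds the exponent of column j below by -n: the hypotheses of
  \<open>dual_coeff_orthogonal\<close>.\<close>

lemma cong_deg_schur_column:
  assumes "1 \<le> i" "i \<le> n" "1 \<le> j" "j \<le> n"
  shows "cong_deg D (laurent_row n i (schur_column mu j))
    (\<Sum>t\<in>{- int n..<int D}. laurent_row n i (dual_coeff t) * mps_const (dual_coeff_inv t (dual_exp mu j)))"
  unfolding cong_deg_def
proof (intro allI impI)
  fix \<alpha> :: "nat \<Rightarrow>\<^sub>0 nat" assume \<alpha>: "mdeg \<alpha> \<le> D"
  let ?k = "int (mdeg \<alpha>) - int i"
  have "(\<Sum>t = - int n..<int D. dual_coeff_inv t (dual_exp mu j) * dual_coeff t ?k) =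
      (if ?k = dual_exp mu j then 1 else 0)"
    by (rule dual_coeff_orthogonal) (use assms \<alpha> in auto)
  then show "mcoeff (laurent_row n i (schur_column mu j)) \<alpha> =
      mcoeff (\<Sum>t\<in>{- int n..<int D}. laurent_row n i (dual_coeff t) * mps_const (dual_coeff_inv t (dual_exp mu j))) \<alpha>"
    by (simp add: mult.commute[of _ "mps_const _"] mcoeff_const_mult mcoeff_laurent_row schur_column_def)
qed

text \<open>Cauchy-Binet applied to the expanded columns, truncated at the degree of \<alpha>; the
  sets of exponents that occur correspond to partitions.\<close>

lemma mcoeff_laurent_det_schur_column:
  fixes mu :: "nat list"
  defines "W la n \<equiv> det_range 1 n (\<lambda>i j. dual_coeff_inv (dual_exp la i) (dual_exp mu j))"
  shows "mcoeff (laurent_det n (schur_column mu)) \<alpha> =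
    (\<Sum>la | is_partition la \<and> length la \<le> n \<and> part la 1 \<le> mdeg \<alpha>.
      W la n * mcoeff (laurent_det n (dual_column la)) \<alpha>)"
proof -
  let ?L = "{la. is_partition la \<and> length la \<le> n \<and> part la 1 \<le> mdeg \<alpha>}"
  let ?S = "{- int n..<int (mdeg \<alpha>)}"
  let ?A = "\<lambda>i t. laurent_row n i (dual_coeff t)"
  let ?B = "\<lambda>t j. mps_const (dual_coeff_inv t (dual_exp mu j))"
  have "cong_deg (mdeg \<alpha>) (laurent_det n (schur_column mu)) (det_range 1 n (\<lambda>i j. \<Sum>t\<in>?S. ?A i t * ?B t j))"
    unfolding laurent_det_def by (rule cong_deg_det_range) (rule cong_deg_schur_column)
  moreover have "det_range 1 n (\<lambda>i j. \<Sum>t\<in>?S. ?A i t * ?B t j) =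
      (\<Sum>la\<in>?L. det_range 1 n (\<lambda>i k. ?A i (dual_exp la k)) * det_range 1 n (\<lambda>k j. ?B (dual_exp la k) j))"
    by (rule cauchy_binet[OF _ bij_betw_partitions_subsets]) simp
  moreover have "\<dots> = (\<Sum>la\<in>?L. mps_const (W la n) * laurent_det n (dual_column la))"
    unfolding W_def det_range_hom[OF mps_const_hom] laurent_det_def dual_column_def
    by (simp add: mult.commute)
  ultimately show ?thesis
    by (simp add: cong_deg_def mcoeff_const_mult)
qed

text \<open>The first column starts at an exponent too large for any row, so it vanishes up to the
  degree of \<alpha>.\<close>

lemma mcoeff_laurent_det_dual_column_eq_0:
  assumes "mdeg \<alpha> < part la 1" "n \<ge> 1"
  shows "mcoeff (laurent_det n (dual_column la)) \<alpha> = 0"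
proof -
  let ?f = "\<lambda>i j. if j = 1 then 0 else laurent_row n i (dual_column la j)"
  have "cong_deg (mdeg \<alpha>) (laurent_det n (dual_column la)) (det_range 1 n ?f)"
    unfolding laurent_det_def
    by (rule cong_deg_det_range)
      (use assms in \<open>auto simp: cong_deg_def mcoeff_laurent_row dual_column_def intro!: dual_coeff_lt\<close>)
  moreover have "det_range 1 n ?f = 0"
    by (rule det_range_zero_col[of _ 1]) (use assms in auto)
  ultimately show ?thesis by (simp add: cong_deg_def)
qed

text \<open>Spares computing the exact support: a finite set containing it is enough.\<close>

lemma has_formal_sumI:
  assumes "\<And>\<alpha>. \<exists>L. finite L \<and> L \<subseteq> I \<and> (\<forall>i\<in>I - L. mcoeff (f i) \<alpha> = 0) \<and> mcoeff S \<alpha> = (\<Sum>i\<in>L. mcoeff (f i) \<alpha>)"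
  shows "has_formal_sum f I S"
  unfolding has_formal_sum_def
proof
  fix \<alpha>
  obtain L where L: "finite L" "L \<subseteq> I" "\<And>i. i \<in> I - L \<Longrightarrow> mcoeff (f i) \<alpha> = 0"
      "mcoeff S \<alpha> = (\<Sum>i\<in>L. mcoeff (f i) \<alpha>)"
    using assms by metis
  have sub: "{i \<in> I. mcoeff (f i) \<alpha> \<noteq> 0} \<subseteq> L" using L(3) by blast
  have "(\<Sum>i\<in>L. mcoeff (f i) \<alpha>) = (\<Sum>i\<in>{i \<in> I. mcoeff (f i) \<alpha> \<noteq> 0}. mcoeff (f i) \<alpha>)"
    by (rule sum.mono_neutral_right[OF L(1) sub]) (use L(2) in blast)
  then show "finite {i \<in> I. mcoeff (f i) \<alpha> \<noteq> 0} \<and>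
      mcoeff S \<alpha> = (\<Sum>i\<in>{i \<in> I. mcoeff (f i) \<alpha> \<noteq> 0}. mcoeff (f i) \<alpha>)"
    using finite_subset[OF sub L(1)] L(4) by simp
qed

theorem proposition3p19:
  fixes mu :: "nat list" and d :: nat
  assumes "is_partition mu" and "num_diag mu = d"
  shows "has_formal_sum
    (\<lambda>la. mps_const
        ((-1) ^ card {(i, j) \<in> diagram la - diagram mu. i \<le> d} *
         det_range 1 d
           (\<lambda>i j. elem_sym (int (part la i) - int (part mu j) - int i + int j)
                    {int i - int (part la i) + 1..0}) *
         det_range (d + 1) (length la)
           (\<lambda>i j. compl_sym (int (part la i) - int (part mu j) - int i + int j)
                    {1..int i - int (part la i)}))
      * dual_schur la)
    {la. is_partition la \<and> diagram mu \<subseteq> diagram la \<and> num_diag la = d}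
    (schur mu)"
    (is "has_formal_sum (\<lambda>la. mps_const (?c la) * dual_schur la) ?I _")
proof (rule has_formal_sumI)
  fix \<alpha> :: "nat \<Rightarrow>\<^sub>0 nat"
  \<comment> \<open>Enough variables both for the monomial \<alpha> and for \<open>mu\<close> to
    have a nontrivial Schur polynomial.\<close>
  define n where "n = max (length mu) (Suc (Max (insert 0 (Poly_Mapping.keys \<alpha>))))"
  have n: "Poly_Mapping.keys \<alpha> \<subseteq> {..<n}" "length mu \<le> n"
    by (auto simp: n_def less_Suc_eq_le less_max_iff_disj)
  let ?L = "{la. is_partition la \<and> length la \<le> n \<and> part la 1 \<le> mdeg \<alpha>}"
  let ?W = "\<lambda>la. det_range 1 n (\<lambda>i j. dual_coeff_inv (dual_exp la i) (dual_exp mu j))"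
  let ?f = "\<lambda>la. mcoeff (mps_const (?c la) * dual_schur la) \<alpha>"
  have finL: "finite ?L"
    using bij_betw_finite[OF bij_betw_partitions_subsets[of n "mdeg \<alpha>"]] by simp
  \<comment> \<open>Such a \<open>la\<close> either has more than n parts, so its function vanishes
    in n variables, or a first part exceeding the degree of \<alpha>.\<close>
  have outside: "?f la = 0" if I: "la \<in> ?I" and L: "la \<notin> ?L" for la
  proof -
    have la: "is_partition la" using I by simp
    have "mcoeff (dual_schur la) \<alpha> = 0"
    proof (cases "length la \<le> n")
      case True
      then have big: "mdeg \<alpha> < part la 1" using L la by auto
      then have "1 \<le> length la" using part_pos_iff[OF la, of 1] by simp
      then show ?thesis
        using True mcoeff_laurent_det_dual_column_eq_0[OF big, of n]
        by (simp add: mcoeff_dual_schur[OF la n(1)])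
    qed (simp add: mcoeff_dual_schur[OF la n(1)])
    then show ?thesis by (simp only: mcoeff_const_mult mult_zero_right)
  qed
  have "mcoeff (schur mu) \<alpha> = (\<Sum>la\<in>?L. ?W la * mcoeff (laurent_det n (dual_column la)) \<alpha>)"
    using mcoeff_schur[OF assms(1) n] by (simp only: mcoeff_laurent_det_schur_column)
  also have "\<dots> = (\<Sum>la\<in>?L \<inter> ?I. ?f la)"
  proof (rule sum.mono_neutral_cong_right[OF finL])
    show "\<forall>la\<in>?L - ?L \<inter> ?I. ?W la * mcoeff (laurent_det n (dual_column la)) \<alpha> = 0"
    proof
      fix la assume "la \<in> ?L - ?L \<inter> ?I"
      then have "?W la = 0" using assms n by (intro det_dual_coeff_inv_eq_0) auto
      then show "?W la * mcoeff (laurent_det n (dual_column la)) \<alpha> = 0" by simp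
    qed
    fix la assume la: "la \<in> ?L \<inter> ?I"
    then have "?W la = ?c la" using assms by (intro det_dual_coeff_inv_eq) auto
    moreover have "mcoeff (dual_schur la) \<alpha> = mcoeff (laurent_det n (dual_column la)) \<alpha>"
      using la n by (simp add: mcoeff_dual_schur)
    ultimately show "?W la * mcoeff (laurent_det n (dual_column la)) \<alpha> = ?f la"
      by (simp only: mcoeff_const_mult)
  qed auto
  finally have eq: "mcoeff (schur mu) \<alpha> = (\<Sum>la\<in>?L \<inter> ?I. ?f la)" .
  show "\<exists>L. finite L \<and> L \<subseteq> ?I \<and> (\<forall>la\<in>?I - L. ?f la = 0) \<and> mcoeff (schur mu) \<alpha> = (\<Sum>la\<in>L. ?f la)"
  proof (intro exI[of _ "?L \<inter> ?I"] conjI ballI)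
    fix la assume "la \<in> ?I - ?L \<inter> ?I"
    then show "?f la = 0" by (intro outside) blast+
  qed (rule finite_Int, rule disjI1, rule finL, rule Int_lower2, rule eq)
qed

end
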